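(* Let $n,m,r,\lambda$ be positive integers with $n>m>2$, and let a partial $r$-factorization of $G:=\lambda K_m$ (with respect to $n$) be given. It can be extended to a connected $r$-factorization of $\lambda K_n$ if and only if (i) $(n,r,\lambda)$ is $2$-admissible; (ii) no component of any color class of $G$ is $r$-regular; (iii) for all $j\in[k]$, where $k:=\lambda(n-1)/r$, $$rm-\frac{rn}{2}\le |E(G(j))|\le \frac{rn}{2}-n+m-c(G(j))+1.$$
   Context: $\lambda K_n$ is the loopless multigraph on $n$ vertices with every pair of vertices joined by $\lambda$ edges; $\lambda K_m$ is its subgraph induced on a fixed set of $m$ vertices. An $r$-factor is a spanning subgraph in which every vertex has degree $r$. With $k=\lambda(n-1)/r$, a partial $r$-factorization of $\lambda K_m$ is a coloring of its edges with colors from $[k]$ such that every vertex has degree at most $r$ in each color class; $G(j)$ is color class $j$ (spanning subgraph on all $m$ vertices, possibly edgeless) and $c(\cdot)$ counts components including isolated vertices. It extends to a connected $r$-factorization of $\lambda K_n$ if some coloring of all edges of $\lambda K_n$ with colors from $[k]$ agrees with it on $\lambda K_m$ and every color class is a connected $r$-factor. $(n,r,\lambda)$ is $2$-admissible if $2\mid rn$ and $r\mid\lambda(n-1)$. *)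

theory Defs
  imports Complex_Main
begin

text \<open>
  A loopless multigraph is given by a vertex set and a set of edges. An edge is a pair of its
  two-element set of endpoints and an index that distinguishes parallel edges.
\<close>

type_synonym 'a medge = "'a set \<times> nat"

definition deg :: "'a medge set \<Rightarrow> 'a \<Rightarrow> nat" where
  "deg E v = card {e \<in> E. v \<in> fst e}"

definition regular :: "nat \<Rightarrow> 'a set \<Rightarrow> 'a medge set \<Rightarrow> bool" where
  "regular r V E \<longleftrightarrow> (\<forall>v\<in>V. deg E v = r)"

definition induced_edges :: "'a medge set \<Rightarrow> 'a set \<Rightarrow> 'a medge set" where
  "induced_edges E W = {e \<in> E. fst e \<subseteq> W}"

definition adj :: "'a medge set \<Rightarrow> ('a \<times> 'a) set" where
  "adj E = {(u, v). \<exists>i. ({u, v}, i) \<in> E}"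

definition linked :: "'a set \<Rightarrow> 'a medge set \<Rightarrow> ('a \<times> 'a) set" where
  "linked V E = {(u, v). u \<in> V \<and> v \<in> V \<and> (u, v) \<in> (adj E)\<^sup>*}"

text \<open>
  Components are represented by their vertex sets; an isolated vertex forms a component. The
  component with vertex set \<open>C\<close> is the graph with edge set \<open>induced_edges E C\<close>.
\<close>

definition components :: "'a set \<Rightarrow> 'a medge set \<Rightarrow> 'a set set" where
  "components V E = V // linked V E"

definition connected_graph :: "'a set \<Rightarrow> 'a medge set \<Rightarrow> bool" where
  "connected_graph V E \<longleftrightarrow> V \<noteq> {} \<and> (\<forall>u\<in>V. \<forall>v\<in>V. (u, v) \<in> linked V E)"

text \<open>
  The multigraph \<open>\<lambda>K\<^sub>n\<close> has vertex set \<open>{..<n}\<close>. For \<open>m \<le> n\<close>, its subgraph induced on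
  \<open>{..<m}\<close> is \<open>\<lambda>K\<^sub>m\<close>.
\<close>

definition lamK :: "nat \<Rightarrow> nat \<Rightarrow> nat medge set" where
  "lamK lam n = {(e, i). e \<subseteq> {..<n} \<and> card e = 2 \<and> i < lam}"

text \<open>
  The colour set is \<open>[k]\<close> with \<open>k = \<lambda>(n - 1)/r\<close>. If \<open>r\<close> does not divide \<open>\<lambda>(n - 1)\<close>,
  this consists of the positive integers up to the rational number \<open>k\<close>.
\<close>

definition colours :: "nat \<Rightarrow> nat \<Rightarrow> nat \<Rightarrow> nat set" where
  "colours n r lam = {1..(lam * (n - 1)) div r}"

text \<open>Colourings are total functions; only their values on the edge set in question matter.\<close>

definition colour_class :: "nat medge set \<Rightarrow> (nat medge \<Rightarrow> nat) \<Rightarrow> nat \<Rightarrow> nat medge set" where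
  "colour_class E f j = {e \<in> E. f e = j}"

definition partial_factorization ::
    "nat \<Rightarrow> nat \<Rightarrow> nat \<Rightarrow> nat \<Rightarrow> (nat medge \<Rightarrow> nat) \<Rightarrow> bool" where
  "partial_factorization n r lam m f \<longleftrightarrow>
     (\<forall>e\<in>lamK lam m. f e \<in> colours n r lam) \<and>
     (\<forall>j\<in>colours n r lam. \<forall>v<m. deg (colour_class (lamK lam m) f j) v \<le> r)"

definition connected_factorization ::
    "nat \<Rightarrow> nat \<Rightarrow> nat \<Rightarrow> (nat medge \<Rightarrow> nat) \<Rightarrow> bool" where
  "connected_factorization n r lam g \<longleftrightarrow>
     (\<forall>e\<in>lamK lam n. g e \<in> colours n r lam) \<and>
     (\<forall>j\<in>colours n r lam.
        regular r {..<n} (colour_class (lamK lam n) g j) \<and>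
        connected_graph {..<n} (colour_class (lamK lam n) g j))"

definition extends_to_connected_factorization ::
    "nat \<Rightarrow> nat \<Rightarrow> nat \<Rightarrow> nat \<Rightarrow> (nat medge \<Rightarrow> nat) \<Rightarrow> bool" where
  "extends_to_connected_factorization n r lam m f \<longleftrightarrow>
     (\<exists>g. connected_factorization n r lam g \<and> (\<forall>e\<in>lamK lam m. g e = f e))"

definition two_admissible :: "nat \<Rightarrow> nat \<Rightarrow> nat \<Rightarrow> bool" where
  "two_admissible n r lam \<longleftrightarrow> 2 dvd r * n \<and> r dvd lam * (n - 1)"

end

theory Submission
  imports Defs
begin

text \<open>
  For the nontrivial direction, add one vertex at a time: a partial factorization of
  \<open>\<lambda>K\<^sub>M\<close> satisfying the conditions extends to one of \<open>\<lambda>K\<^sub>M\<^sub>+\<^sub>1\<close> satisfying them,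
  and for \<open>M = n\<close> they force every colour class to be a connected \<open>r\<close>-factor. Amalgamate the
  \<open>p\<close> missing vertices into one. The new vertex takes a fair \<open>1/p\<close> share (up to rounding) of
  the half-edges at the amalgamated vertex, simultaneously for two laminar families: the half-edges
  leading to a given vertex, and, in each colour, all half-edges, those of the loops, those leading
  to a given component, and the union of the loops with the components that are attached by at
  least two edges. Fairness on this last set prevents the new vertex from closing off a component.
  Conversely, contracting the components of a colour class shows that at least
  \<open>c(G(j)) + n - m - 1\<close> further edges are needed to make it connected.
\<close>

section \<open>Fair rounding for two laminar families\<close>

definition laminar :: "'a set set \<Rightarrow> bool" where
  "laminar F \<longleftrightarrow> (\<forall>P\<in>F. \<forall>Q\<in>F. P \<subseteq> Q \<or> Q \<subseteq> P \<or> P \<inter> Q = {})"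

text \<open>Each orbit \<open>{x, \<tau> x}\<close> gets one representative \<open>z x\<close>;
  depending only on the orbit, the choice separates the two elements of every proper pair.\<close>

lemma involution_two_colouring:
  assumes "\<And>x. \<tau> (\<tau> x) = x"
  shows "\<exists>c :: 'a \<Rightarrow> bool. \<forall>x. \<tau> x \<noteq> x \<longrightarrow> c (\<tau> x) = (\<not> c x)"
proof -
  define z where "z x = (SOME y. y \<in> {x, \<tau> x})" for x
  have "z x \<in> {x, \<tau> x}" for x
    unfolding z_def by (rule someI[of _ x]) simp
  moreover have "z (\<tau> x) = z x" for x
    unfolding z_def using assms by (simp add: insert_commute)
  ultimately show ?thesis
    by (intro exI[of _ "\<lambda>x. x = z x"]) (metis insertE singletonD)
qed

text \<open>The 2-cycles of the two involutions form two matchings, whose union consists of paths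
  and even cycles and is therefore bipartite. The induction deletes one \<open>\<sigma>\<close>-pair
  \<open>x\<close>, \<open>y\<close> and contracts the alternating path through it.\<close>

lemma two_involutions_two_colouring:
  assumes "finite {x. \<sigma> x \<noteq> x}" "\<And>x. \<sigma> (\<sigma> x) = x" "\<And>x. \<tau> (\<tau> x) = x"
  shows "\<exists>c :: 'a \<Rightarrow> bool. \<forall>x. (\<sigma> x \<noteq> x \<longrightarrow> c (\<sigma> x) = (\<not> c x)) \<and> (\<tau> x \<noteq> x \<longrightarrow> c (\<tau> x) = (\<not> c x))"
  using assms
proof (induction "card {x. \<sigma> x \<noteq> x}" arbitrary: \<sigma> \<tau> rule: less_induct)
  case less
  note inv = less.prems(2,3)
  show ?case
  proof (cases "\<exists>x. \<sigma> x \<noteq> x")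
    case False
    then show ?thesis using involution_two_colouring[of \<tau>] inv by auto
  next
    case True
    then obtain x y where xy: "\<sigma> x = y" "y \<noteq> x" by blast
    then have yx: "\<sigma> y = x" using inv by metis
    define z w where "z = \<tau> x" and "w = \<tau> y"
    define \<sigma>' where "\<sigma>' u = (if u = x \<or> u = y then u else \<sigma> u)" for u
    \<comment> \<open>The \<open>\<tau>\<close>-partners \<open>z\<close> of \<open>x\<close> and
      \<open>w\<close> of \<open>y\<close> become partners of each other, so a colouring for
      \<open>\<tau>'\<close> separates them, as the path z, x, y, w demands. If one of
      \<open>x\<close>, \<open>y\<close> is fixed by \<open>\<tau>\<close>, the partner of the other
      becomes a fixed point.\<close>
    define \<tau>' where "\<tau>' u = (if u = x \<or> u = y then u
      else if \<tau> u = x then (if w = y then u else w)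
      else if \<tau> u = y then (if z = x then u else z) else \<tau> u)" for u
    have "{u. \<sigma>' u \<noteq> u} \<subset> {u. \<sigma> u \<noteq> u}"
      using xy unfolding \<sigma>'_def by auto
    then have card: "card {u. \<sigma>' u \<noteq> u} < card {u. \<sigma> u \<noteq> u}" "finite {u. \<sigma>' u \<noteq> u}"
      using less.prems(1) by (auto intro: psubset_card_mono finite_subset)
    have s: "\<sigma>' (\<sigma>' u) = u" for u
      unfolding \<sigma>'_def using inv(1)[of u] xy yx by auto
    have t: "\<tau>' (\<tau>' u) = u" for u
      unfolding \<tau>'_def z_def w_def using inv(2)[of u] inv(2)[of x] inv(2)[of y] xy
      by (smt (verit))
    obtain c where c: "\<And>u. \<sigma>' u \<noteq> u \<Longrightarrow> c (\<sigma>' u) = (\<not> c u)"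
      "\<And>u. \<tau>' u \<noteq> u \<Longrightarrow> c (\<tau>' u) = (\<not> c u)"
      using less.hyps[OF card(1) card(2) s t] by blast
    \<comment> \<open>\<open>x\<close> must differ from \<open>z\<close>, and \<open>y\<close>,
      coloured opposite to \<open>x\<close>, must differ from \<open>w\<close>, so \<open>x\<close>
      agrees with \<open>w\<close>. When both constraints are present they coincide, since
      \<open>z\<close> and \<open>w\<close> differ; when neither is, the value \<open>True\<close>
      is arbitrary.\<close>
    define cx where "cx = (if z \<noteq> x \<and> z \<noteq> y then \<not> c z else if w \<noteq> x \<and> w \<noteq> y then c w else True)"
    define c' where "c' = c(x := cx, y := \<not> cx)"
    have "c' (\<sigma> u) = (\<not> c' u)" if "\<sigma> u \<noteq> u" for u
    proof (cases "u = x \<or> u = y")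
      case True then show ?thesis using xy yx unfolding c'_def by auto
    next
      case False
      then have "\<sigma> u \<noteq> x" "\<sigma> u \<noteq> y" using inv(1)[of u] xy yx by auto
      then show ?thesis using c(1)[of u] that False unfolding \<sigma>'_def c'_def by auto
    qed
    moreover have "c' (\<tau> u) = (\<not> c' u)" if "\<tau> u \<noteq> u" for u
    proof -
      have zw: "\<tau> z = x" "\<tau> w = y" "z \<noteq> w" unfolding z_def w_def using inv(2) xy by metis+
      have cw: "c z = (\<not> c w)" if "z \<noteq> x" "z \<noteq> y" "w \<noteq> x" "w \<noteq> y"
        using c(2)[of z] that zw unfolding \<tau>'_def by auto
      consider "u = x" | "u = y" | "u \<noteq> x" "u \<noteq> y" "\<tau> u = x" | "u \<noteq> x" "u \<noteq> y" "\<tau> u = y"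
        | "u \<noteq> x" "u \<noteq> y" "\<tau> u \<noteq> x" "\<tau> u \<noteq> y" by blast
      then show ?thesis
      proof cases
        case 1
        then have "\<tau> u = z" "z \<noteq> x" using that z_def by auto
        then show ?thesis using 1 xy unfolding c'_def cx_def by auto
      next
        case 2
        then have *: "\<tau> u = w" "w \<noteq> y" using that w_def by auto
        have "z = y" if "w = x" using that zw z_def by simp
        moreover have "z \<noteq> y" if "w \<noteq> x" using that zw w_def by auto
        ultimately show ?thesis using 2 * xy cw unfolding c'_def cx_def by auto
      next
        case 3
        then have "u = z" using zw z_def inv(2) by metis
        then show ?thesis using 3 xy unfolding c'_def cx_def by auto
      next
        case 4
        then have "u = w" using zw w_def inv(2) by metis
        moreover have "z \<noteq> y" using 4 calculation zw unfolding w_def by auto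
        ultimately show ?thesis using 4 xy cw unfolding c'_def cx_def by auto
      next
        case 5
        then show ?thesis using c(2)[of u] that unfolding \<tau>'_def c'_def by auto
      qed
    qed
    ultimately show ?thesis by blast
  qed
qed

text \<open>Serves for shrinking all members at once: by deleting two points, or by restricting to
  two colours.\<close>

lemma laminar_image:
  assumes "laminar F" "\<And>P Q. P \<in> F \<Longrightarrow> Q \<in> F \<Longrightarrow> P \<subseteq> Q \<Longrightarrow> h P \<subseteq> h Q"
    "\<And>P Q. P \<in> F \<Longrightarrow> Q \<in> F \<Longrightarrow> P \<inter> Q = {} \<Longrightarrow> h P \<inter> h Q = {}"
  shows "laminar (h ` F)"
  using assms unfolding laminar_def by (smt (verit) image_iff)

text \<open>
  Pairing two elements of a smallest member with at least two elements cuts only singletons.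
\<close>

lemma laminar_matching:
  assumes "finite S" "laminar F" "\<Union>F \<subseteq> S"
  shows "\<exists>\<sigma>. (\<forall>x. \<sigma> (\<sigma> x) = x) \<and> (\<forall>x. x \<notin> S \<longrightarrow> \<sigma> x = x) \<and>
    (\<forall>P\<in>F. card {x \<in> P. \<sigma> x = x \<or> \<sigma> x \<notin> P} \<le> 1)"
  using assms
proof (induction "card S" arbitrary: S F rule: less_induct)
  case less
  have fin: "finite P" if "P \<in> F" for P
    using less.prems that by (meson Union_upper finite_subset subset_trans)
  show ?case
  proof (cases "\<exists>P\<in>F. card P \<ge> 2")
    case False
    then have "card {x \<in> P. id x = x \<or> id x \<notin> P} \<le> 1" if "P \<in> F" for P
      using that by fastforce
    then show ?thesis by (intro exI[of _ id]) simp
  next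
    case True
    then obtain P where P: "P \<in> F" "card P \<ge> 2" and
      min: "\<And>Q. Q \<in> F \<Longrightarrow> card Q \<ge> 2 \<Longrightarrow> card P \<le> card Q"
      using ex_has_least_nat[of "\<lambda>P. P \<in> F \<and> card P \<ge> 2" _ card] by blast
    obtain x y where xy: "x \<in> P" "y \<in> P" "x \<noteq> y"
      using P(2) fin[OF P(1)] by (metis One_nat_def Suc_1 card_le_Suc0_iff_eq not_less_eq_eq)
    have xyS: "x \<in> S" "y \<in> S" using xy P less.prems(3) by auto
    let ?F = "(\<lambda>Q. Q - {x, y}) ` F"
    have "card (S - {x, y}) < card S"
      using xyS less.prems(1) by (intro psubset_card_mono) auto
    moreover have "laminar ?F" by (rule laminar_image[OF less.prems(2)]) auto
    moreover have "\<Union>?F \<subseteq> S - {x, y}" using less.prems(3) by auto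
    ultimately have "\<exists>\<sigma>. (\<forall>u. \<sigma> (\<sigma> u) = u) \<and> (\<forall>u. u \<notin> S - {x, y} \<longrightarrow> \<sigma> u = u) \<and>
      (\<forall>Q\<in>?F. card {u \<in> Q. \<sigma> u = u \<or> \<sigma> u \<notin> Q} \<le> 1)"
      using less.hyps[of "S - {x, y}" ?F] less.prems(1) by blast
    then obtain \<sigma> where \<sigma>: "\<And>u. \<sigma> (\<sigma> u) = u" "\<And>u. u \<notin> S - {x, y} \<Longrightarrow> \<sigma> u = u"
      "\<And>Q. Q \<in> F \<Longrightarrow> card {u \<in> Q - {x, y}. \<sigma> u = u \<or> \<sigma> u \<notin> Q - {x, y}} \<le> 1"
      unfolding ball_simps(9) by blast
    define \<sigma>' where "\<sigma>' = \<sigma>(x := y, y := x)"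
    have \<sigma>xy: "\<sigma> u \<noteq> x" "\<sigma> u \<noteq> y" if "u \<noteq> x" "u \<noteq> y" for u
      using \<sigma>(1)[of u] \<sigma>(2)[of x] \<sigma>(2)[of y] that by auto
    have "\<sigma>' (\<sigma>' u) = u" for u
      using \<sigma>(1)[of u] \<sigma>xy[of u] xy(3) unfolding \<sigma>'_def by auto
    moreover have "\<sigma>' u = u" if "u \<notin> S" for u
      using \<sigma>(2)[of u] that xyS unfolding \<sigma>'_def by auto
    moreover have "card {u \<in> Q. \<sigma>' u = u \<or> \<sigma>' u \<notin> Q} \<le> 1" if Q: "Q \<in> F" for Q
    proof (cases "x \<in> Q \<longleftrightarrow> y \<in> Q")
      case True
      then have "{u \<in> Q. \<sigma>' u = u \<or> \<sigma>' u \<notin> Q} = {u \<in> Q - {x, y}. \<sigma> u = u \<or> \<sigma> u \<notin> Q - {x, y}}"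
        using \<sigma>xy xy(3) unfolding \<sigma>'_def by auto
      then show ?thesis using \<sigma>(3)[OF Q] by simp
    next
      case False
      then have "\<not> P \<subseteq> Q" "P \<inter> Q \<noteq> {}" using xy by auto
      then have "Q \<subset> P" using less.prems(2) P(1) Q unfolding laminar_def by blast
      then have "card Q < card P" using fin[OF P(1)] by (rule psubset_card_mono[rotated])
      then have "card Q \<le> 1" using min[OF Q] by linarith
      then show ?thesis using card_mono[OF fin[OF Q], of "{u \<in> Q. \<sigma>' u = u \<or> \<sigma>' u \<notin> Q}"] by auto
    qed
    ultimately show ?thesis by blast
  qed
qed

text \<open>Pairs of the matching inside \<open>P\<close> contribute equally to both colours, so an
  imbalance can only come from the at most one element that has no partner in
  \<open>P\<close>.\<close>

lemma matching_balanced: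
  assumes "finite P" "\<And>x. \<sigma> (\<sigma> x) = x" "\<And>x. \<sigma> x \<noteq> x \<Longrightarrow> c (\<sigma> x) = (\<not> c x)"
    "card {x \<in> P. \<sigma> x = x \<or> \<sigma> x \<notin> P} \<le> 1"
  shows "card {x \<in> P. c x} \<le> card {x \<in> P. \<not> c x} + 1"
    "card {x \<in> P. \<not> c x} \<le> card {x \<in> P. c x} + 1"
proof -
  define U where "U = {x \<in> P. \<not> (\<sigma> x = x \<or> \<sigma> x \<notin> P)}"
  define R where "R = {x \<in> P. \<sigma> x = x \<or> \<sigma> x \<notin> P}"
  have UR: "P = U \<union> R" "U \<inter> R = {}" "finite U" "finite R"
    using assms(1) unfolding U_def R_def by auto
  have "bij_betw \<sigma> {x \<in> U. c x} {x \<in> U. \<not> c x}"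
    by (rule bij_betw_byWitness[where f' = \<sigma>]) (use assms(2,3) in \<open>auto simp: U_def\<close>)
  then have eq: "card {x \<in> U. c x} = card {x \<in> U. \<not> c x}" by (rule bij_betw_same_card)
  have sp: "card {x \<in> P. q x} = card {x \<in> U. q x} + card {x \<in> R. q x}" for q
    unfolding UR(1) using UR by (subst card_Un_disjoint[symmetric]) (auto intro!: arg_cong[where f = card])
  have le: "card {x \<in> R. q x} \<le> 1" for q
    using card_mono[OF UR(4), of "{x \<in> R. q x}"] assms(4) unfolding R_def[symmetric] by auto
  show "card {x \<in> P. c x} \<le> card {x \<in> P. \<not> c x} + 1"
    "card {x \<in> P. \<not> c x} \<le> card {x \<in> P. c x} + 1"
    using sp[of c] sp[of "\<lambda>x. \<not> c x"] eq le[of c] le[of "\<lambda>x. \<not> c x"] by linarith+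
qed

text \<open>Each family supplies a matching that leaves at most one element of every member without
  a partner inside it. A 2-colouring that is proper for both matchings at once balances both
  families.\<close>

lemma laminar_bipartition:
  assumes "finite S" "laminar F" "\<Union>F \<subseteq> S" "laminar G" "\<Union>G \<subseteq> S"
  shows "\<exists>c :: 'a \<Rightarrow> bool. \<forall>P\<in>F \<union> G. card {x \<in> P. c x} \<le> card {x \<in> P. \<not> c x} + 1 \<and>
    card {x \<in> P. \<not> c x} \<le> card {x \<in> P. c x} + 1"
proof -
  obtain \<sigma> where \<sigma>: "\<And>x. \<sigma> (\<sigma> x) = x" "\<And>x. x \<notin> S \<Longrightarrow> \<sigma> x = x"
    "\<And>P. P \<in> F \<Longrightarrow> card {x \<in> P. \<sigma> x = x \<or> \<sigma> x \<notin> P} \<le> 1"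
    using laminar_matching[OF assms(1-3)] by blast
  obtain \<tau> where \<tau>: "\<And>x. \<tau> (\<tau> x) = x"
    "\<And>P. P \<in> G \<Longrightarrow> card {x \<in> P. \<tau> x = x \<or> \<tau> x \<notin> P} \<le> 1"
    using laminar_matching[OF assms(1,4,5)] by blast
  have "finite {x. \<sigma> x \<noteq> x}" using \<sigma>(2) assms(1) by (metis (mono_tags) finite_subset mem_Collect_eq subsetI)
  then obtain c where c: "\<And>x. \<sigma> x \<noteq> x \<Longrightarrow> c (\<sigma> x) = (\<not> c x)" "\<And>x. \<tau> x \<noteq> x \<Longrightarrow> c (\<tau> x) = (\<not> c x)"
    using two_involutions_two_colouring[of \<sigma> \<tau>] \<sigma>(1) \<tau>(1) by blast
  have fin: "finite P" if "P \<in> F \<union> G" for P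
    using that assms by (meson UnE Union_upper finite_subset subset_trans)
  show ?thesis
  proof (intro exI[of _ c] ballI)
    fix P assume P: "P \<in> F \<union> G"
    then consider "P \<in> F" | "P \<in> G" by blast
    then show "card {x \<in> P. c x} \<le> card {x \<in> P. \<not> c x} + 1 \<and>
      card {x \<in> P. \<not> c x} \<le> card {x \<in> P. c x} + 1"
      using matching_balanced[of P \<sigma> c, OF fin[OF P] \<sigma>(1) c(1) \<sigma>(3)]
        matching_balanced[of P \<tau> c, OF fin[OF P] \<tau>(1) c(2) \<tau>(2)] by cases auto
  qed
qed

text \<open>By \<open>2 * (x\<^sup>2 + y\<^sup>2) = (x + y)\<^sup>2 + (x - y)\<^sup>2\<close>, for a
  fixed sum only the difference matters, and the difference of \<open>u\<close> and \<open>v\<close>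
  is as small as parity allows.\<close>

lemma sum_squares_balanced:
  fixes u v a b :: nat
  assumes "u + v = a + b" "u \<le> v + 1" "v \<le> u + 1"
  shows "u\<^sup>2 + v\<^sup>2 \<le> a\<^sup>2 + b\<^sup>2" "b + 1 < a \<Longrightarrow> u\<^sup>2 + v\<^sup>2 < a\<^sup>2 + b\<^sup>2"
proof -
  have id: "2 * (x\<^sup>2 + y\<^sup>2) = (x + y)\<^sup>2 + (x - y)\<^sup>2" for x y :: int
    by (simp add: power2_eq_square algebra_simps)
  have uv: "(int u - int v)\<^sup>2 \<le> 1"
    using assms(2,3) power_mono[of "\<bar>int u - int v\<bar>" 1 2] by simp
  have ab: "(int u - int v)\<^sup>2 \<le> (int a - int b)\<^sup>2"
  \<comment> \<open>If \<open>a = b\<close>, the common sum is even, which rules out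
    \<open>u\<close> and \<open>v\<close> differing by exactly one.\<close>
  proof (cases "a = b")
    case True
    then have "u = v" using assms by presburger
    then show ?thesis by simp
  next
    case False
    then have "1 \<le> \<bar>int a - int b\<bar>" by simp
    then have "1 \<le> (int a - int b)\<^sup>2" using power_mono[of 1 "\<bar>int a - int b\<bar>" 2] by simp
    then show ?thesis using uv by linarith
  qed
  have s: "int u + int v = int a + int b" using assms(1) by linarith
  have "2 * (int u^2 + int v^2) \<le> 2 * (int a^2 + int b^2)" using ab s unfolding id by simp
  then have "int (u\<^sup>2 + v\<^sup>2) \<le> int (a\<^sup>2 + b\<^sup>2)" by simp
  then show "u\<^sup>2 + v\<^sup>2 \<le> a\<^sup>2 + b\<^sup>2" by linarith
  assume "b + 1 < a"
  then have "2 \<le> int a - int b" by simp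
  then have "4 \<le> (int a - int b)\<^sup>2" using power_mono[of 2 "int a - int b" 2] by simp
  then have "2 * (int u^2 + int v^2) < 2 * (int a^2 + int b^2)" using uv s unfolding id by simp
  then have "int (u\<^sup>2 + v\<^sup>2) < int (a\<^sup>2 + b\<^sup>2)" by simp
  then show "u\<^sup>2 + v\<^sup>2 < a\<^sup>2 + b\<^sup>2" by linarith
qed

text \<open>
  A colouring that minimises the sum of the squares of the sizes of the colour classes within all
  members cannot be improved by rebalancing two colours, so it is equitable.
\<close>

lemma laminar_equitable_colouring:
  assumes "finite S" "laminar F" "\<Union>F \<subseteq> S" "laminar G" "\<Union>G \<subseteq> S" "p > 0"
  shows "\<exists>\<chi> :: 'a \<Rightarrow> nat. (\<forall>x. \<chi> x < p) \<and>
    (\<forall>P\<in>F \<union> G. \<forall>i<p. \<forall>j<p. card {x \<in> P. \<chi> x = i} \<le> card {x \<in> P. \<chi> x = j} + 1)"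
proof -
  define \<Phi> where "\<Phi> \<chi> = (\<Sum>P\<in>F \<union> G. \<Sum>i<p. (card {x \<in> P. \<chi> x = i})\<^sup>2)" for \<chi> :: "'a \<Rightarrow> nat"
  have "\<exists>\<chi>. (\<forall>x. \<chi> x < p) \<and> (\<forall>\<chi>'. (\<forall>x. \<chi>' x < p) \<longrightarrow> \<Phi> \<chi> \<le> \<Phi> \<chi>')"
    using ex_has_least_nat[of "\<lambda>\<chi>. \<forall>x. \<chi> x < p" "\<lambda>x. 0" \<Phi>] assms(6) by blast
  then obtain \<chi> where \<chi>: "\<And>x. \<chi> x < p" and min: "\<And>\<chi>'. (\<And>x. \<chi>' x < p) \<Longrightarrow> \<Phi> \<chi> \<le> \<Phi> \<chi>'"
    by blast
  have fin: "finite P" if "P \<in> F \<union> G" for P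
    using that assms by (meson UnE Union_upper finite_subset subset_trans)
  have finFG: "finite (F \<union> G)"
    by (rule finite_subset[of _ "Pow S"]) (use assms in auto)
  have "card {x \<in> P. \<chi> x = i} \<le> card {x \<in> P. \<chi> x = j} + 1"
    if P: "P \<in> F \<union> G" and ij: "i < p" "j < p" for P i j
  proof (rule ccontr)
    assume bad: "\<not> ?thesis"
    then have "i \<noteq> j" by auto
    \<comment> \<open>Only elements coloured \<open>i\<close> or \<open>j\<close> are recoloured.
      Cutting the members down to these elements keeps both families laminar, so one bipartition
      rebalances all of them together.\<close>
    let ?h = "\<lambda>P. {x \<in> P. \<chi> x = i \<or> \<chi> x = j}"
    have "laminar (?h ` F)" "laminar (?h ` G)"
      by (rule laminar_image[OF assms(2)] laminar_image[OF assms(4)]; blast)+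
    moreover have "\<Union>(?h ` F) \<subseteq> S" "\<Union>(?h ` G) \<subseteq> S" using assms by auto
    ultimately have "\<exists>c. \<forall>P\<in>?h ` (F \<union> G). card {x \<in> P. c x} \<le> card {x \<in> P. \<not> c x} + 1 \<and>
      card {x \<in> P. \<not> c x} \<le> card {x \<in> P. c x} + 1"
      using laminar_bipartition[OF assms(1), of "?h ` F" "?h ` G"] unfolding image_Un by blast
    then obtain c where c:
      "\<And>P. P \<in> F \<union> G \<Longrightarrow> card {x \<in> ?h P. c x} \<le> card {x \<in> ?h P. \<not> c x} + 1"
      "\<And>P. P \<in> F \<union> G \<Longrightarrow> card {x \<in> ?h P. \<not> c x} \<le> card {x \<in> ?h P. c x} + 1"
      unfolding ball_simps(9) by blast
    define \<chi>' where "\<chi>' x = (if \<chi> x = i \<or> \<chi> x = j then if c x then i else j else \<chi> x)" for x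
    define T where "T \<psi> Q = (\<Sum>k<p. (card {x \<in> Q. \<psi> x = k})\<^sup>2)" for \<psi> :: "'a \<Rightarrow> nat" and Q
    have split: "T \<psi> Q = (card {x \<in> Q. \<psi> x = i})\<^sup>2 + (card {x \<in> Q. \<psi> x = j})\<^sup>2
      + (\<Sum>k\<in>{..<p} - {i, j}. (card {x \<in> Q. \<psi> x = k})\<^sup>2)" for \<psi> :: "'a \<Rightarrow> nat" and Q
    proof -
      have "T \<psi> Q = (\<Sum>k\<in>{i, j}. (card {x \<in> Q. \<psi> x = k})\<^sup>2)
        + (\<Sum>k\<in>{..<p} - {i, j}. (card {x \<in> Q. \<psi> x = k})\<^sup>2)"
        unfolding T_def using ij by (subst sum.union_disjoint[symmetric]) (auto intro!: sum.cong)
      then show ?thesis using \<open>i \<noteq> j\<close> by simp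
    qed
    have rest: "(\<Sum>k\<in>{..<p} - {i, j}. (card {x \<in> Q. \<chi>' x = k})\<^sup>2) =
      (\<Sum>k\<in>{..<p} - {i, j}. (card {x \<in> Q. \<chi> x = k})\<^sup>2)" for Q
    proof (rule sum.cong)
      fix k assume "k \<in> {..<p} - {i, j}"
      then have "{x \<in> Q. \<chi>' x = k} = {x \<in> Q. \<chi> x = k}" unfolding \<chi>'_def by auto
      then show "(card {x \<in> Q. \<chi>' x = k})\<^sup>2 = (card {x \<in> Q. \<chi> x = k})\<^sup>2" by simp
    qed simp
    have new: "{x \<in> Q. \<chi>' x = i} = {x \<in> ?h Q. c x}" "{x \<in> Q. \<chi>' x = j} = {x \<in> ?h Q. \<not> c x}" for Q
      using \<open>i \<noteq> j\<close> unfolding \<chi>'_def by auto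
    have tot: "card {x \<in> Q. \<chi>' x = i} + card {x \<in> Q. \<chi>' x = j} =
      card {x \<in> Q. \<chi> x = i} + card {x \<in> Q. \<chi> x = j}" if "Q \<in> F \<union> G" for Q
    proof -
      have "card {x \<in> ?h Q. c x} + card {x \<in> ?h Q. \<not> c x} = card (?h Q)"
        using fin[OF that] by (subst card_Un_disjoint[symmetric]) (auto intro!: arg_cong[where f = card])
      moreover have "card {x \<in> Q. \<chi> x = i} + card {x \<in> Q. \<chi> x = j} = card (?h Q)"
        using fin[OF that] \<open>i \<noteq> j\<close> by (subst card_Un_disjoint[symmetric]) (auto intro!: arg_cong[where f = card])
      ultimately show ?thesis unfolding new by simp
    qed
    have le: "T \<chi>' Q \<le> T \<chi> Q" if "Q \<in> F \<union> G" for Q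
      using sum_squares_balanced(1)[OF tot[OF that]] c[OF that] rest unfolding split new by simp
    \<comment> \<open>In \<open>P\<close> the two classes differed in size by at least two, so
      rebalancing lowers its contribution strictly, while no other contribution rises.\<close>
    have "T \<chi>' P < T \<chi> P"
      using sum_squares_balanced(2)[OF tot[OF P]] c[OF P] bad rest unfolding split new by simp
    then have "\<Phi> \<chi>' < \<Phi> \<chi>"
      unfolding \<Phi>_def T_def[symmetric] using le P finFG by (intro sum_strict_mono_ex1) auto
    moreover have "\<chi>' x < p" for x using \<chi> ij unfolding \<chi>'_def by auto
    ultimately show False using min by (meson leD)
  qed
  then show ?thesis using \<chi> by blast
qed

text \<open>Any one class of an equitable colouring with \<open>p\<close> colours is a fair share;
  class 0 is taken.\<close>

lemma laminar_fair_subset: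
  assumes "finite S" "laminar F" "\<Union>F \<subseteq> S" "laminar G" "\<Union>G \<subseteq> S" "p > 0"
  shows "\<exists>A. \<forall>P\<in>F \<union> G. p * card (P \<inter> A) < card P + p \<and> card P < p * card (P \<inter> A) + p"
proof -
  obtain \<chi> :: "'a \<Rightarrow> nat" where \<chi>: "\<And>x. \<chi> x < p" and
    eq: "\<And>P i j. P \<in> F \<union> G \<Longrightarrow> i < p \<Longrightarrow> j < p \<Longrightarrow>
      card {x \<in> P. \<chi> x = i} \<le> card {x \<in> P. \<chi> x = j} + 1"
    using laminar_equitable_colouring[OF assms] by blast
  have "p * card (P \<inter> {x. \<chi> x = 0}) < card P + p \<and> card P < p * card (P \<inter> {x. \<chi> x = 0}) + p"
    if P: "P \<in> F \<union> G" for P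
  proof -
    have fin: "finite P"
      using P assms by (meson UnE Union_upper finite_subset subset_trans)
    let ?a = "\<lambda>i. card {x \<in> P. \<chi> x = i}"
    have "card P = (\<Sum>i<p. ?a i)"
      using sum_fun_comp[OF fin, of "{..<p}" \<chi> "\<lambda>_. 1 :: nat"] \<chi> by auto
    also have "\<dots> = ?a 0 + (\<Sum>i\<in>{..<p} - {0}. ?a i)"
      using assms(6) by (intro sum.remove) auto
    finally have c: "card P = ?a 0 + (\<Sum>i\<in>{..<p} - {0}. ?a i)" .
    \<comment> \<open>Each of the other \<open>p - 1\<close> classes deviates from class 0 by at
      most one, so the total error is at most \<open>p - 1\<close>, which yields the strict bounds
      with \<open>p\<close>.\<close>
    have "(\<Sum>i\<in>{..<p} - {0}. ?a i) \<le> (\<Sum>i\<in>{..<p} - {0}. ?a 0 + 1)"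
      using eq[OF P _ assms(6)] by (intro sum_mono) auto
    then have u: "card P \<le> ?a 0 + (p - 1) * (?a 0 + 1)" using c assms(6) by simp
    have "(\<Sum>i\<in>{..<p} - {0}. ?a 0) \<le> (\<Sum>i\<in>{..<p} - {0}. ?a i + 1)"
      using eq[OF P assms(6)] by (intro sum_mono) auto
    also have "\<dots> = (\<Sum>i\<in>{..<p} - {0}. ?a i) + (p - 1)"
      using assms(6) by (subst sum.distrib) simp
    finally have l: "?a 0 + (p - 1) * ?a 0 \<le> card P + (p - 1)"
      using c assms(6) by simp
    obtain q where "p = Suc q" using assms(6) by (cases p) auto
    then show ?thesis using u l by (simp add: Int_def algebra_simps)
  qed
  then show ?thesis by blast
qed

lemma fair_rounding:
  fixes d :: "'j \<Rightarrow> 'v \<Rightarrow> nat"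
  assumes "finite K" "finite V" "p > 0"
    and lam: "\<And>j. j \<in> K \<Longrightarrow> laminar (L j)" "\<And>j. j \<in> K \<Longrightarrow> \<Union>(L j) \<subseteq> V"
  obtains a where "\<And>j v. a j v \<le> d j v"
    and "\<And>j X. j \<in> K \<Longrightarrow> X \<in> L j \<Longrightarrow> p * (\<Sum>v\<in>X. a j v) < (\<Sum>v\<in>X. d j v) + p \<and>
      (\<Sum>v\<in>X. d j v) < p * (\<Sum>v\<in>X. a j v) + p"
    and "\<And>v. v \<in> V \<Longrightarrow> p * (\<Sum>j\<in>K. a j v) < (\<Sum>j\<in>K. d j v) + p \<and>
      (\<Sum>j\<in>K. d j v) < p * (\<Sum>j\<in>K. a j v) + p"
proof -
  \<comment> \<open>Every entry \<open>d j v\<close> is replaced by that many unit elements, so that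
    sums of entries become cardinalities. \<open>F\<close> consists of sets within single rows
    \<open>j\<close>, \<open>G\<close> of the full columns \<open>v\<close>; choosing units fairly
    and counting them per entry gives \<open>a\<close>.\<close>
  define H where "H J X = (SIGMA j:J. SIGMA v:X. {..<d j v})" for J X
  define F where "F = (\<Union>j\<in>K. H {j} ` L j)"
  define G where "G = (\<lambda>v. H K {v}) ` V"
  have fH: "finite (H J X)" if "finite J" "finite X" for J X
    unfolding H_def using that by auto
  have sub: "H J X \<subseteq> H J' X'" if "J \<subseteq> J'" "X \<subseteq> X'" for J J' X X'
    unfolding H_def using that by auto
  have dis: "H J X \<inter> H J' X' = {}" if "J \<inter> J' = {} \<or> X \<inter> X' = {}" for J J' X X'
    unfolding H_def using that by auto
  have F: "laminar F"
    unfolding laminar_def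
  proof (intro ballI)
    fix P Q assume "P \<in> F" "Q \<in> F"
    then obtain i j X Y where *: "i \<in> K" "j \<in> K" "X \<in> L i" "Y \<in> L j" "P = H {i} X" "Q = H {j} Y"
      unfolding F_def by blast
    show "P \<subseteq> Q \<or> Q \<subseteq> P \<or> P \<inter> Q = {}"
    proof (cases "i = j")
      case True
      then have "X \<subseteq> Y \<or> Y \<subseteq> X \<or> X \<inter> Y = {}" using * lam(1) unfolding laminar_def by blast
      then show ?thesis unfolding *(5,6) True by (metis dis order_refl sub)
    next
      case False
      then show ?thesis unfolding *(5,6) by (simp add: dis)
    qed
  qed
  have G: "laminar G"
    unfolding laminar_def
  proof (intro ballI)
    fix P Q assume "P \<in> G" "Q \<in> G"
    then obtain x y where *: "P = H K {x}" "Q = H K {y}" unfolding G_def by blast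
    show "P \<subseteq> Q \<or> Q \<subseteq> P \<or> P \<inter> Q = {}"
      unfolding * by (cases "x = y") (simp_all add: dis)
  qed
  have FS: "\<Union>F \<subseteq> H K V" unfolding F_def using lam(2) by (auto simp: H_def)
  have GS: "\<Union>G \<subseteq> H K V" unfolding G_def by (auto simp: H_def)
  obtain A where A: "\<And>P. P \<in> F \<union> G \<Longrightarrow> p * card (P \<inter> A) < card P + p \<and> card P < p * card (P \<inter> A) + p"
    using laminar_fair_subset[OF fH[OF assms(1,2)] F FS G GS assms(3)] by blast
  define a where "a j v = card {i \<in> {..<d j v}. (j, v, i) \<in> A}" for j v
  have cH: "card (H J X) = (\<Sum>j\<in>J. \<Sum>v\<in>X. d j v)" if "finite J" "finite X" for J X
    unfolding H_def using that by simp
  have "H J X \<inter> A = (SIGMA j:J. SIGMA v:X. {i \<in> {..<d j v}. (j, v, i) \<in> A})" for J X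
    unfolding H_def by auto
  then have cA: "card (H J X \<inter> A) = (\<Sum>j\<in>J. \<Sum>v\<in>X. a j v)" if "finite J" "finite X" for J X
    unfolding a_def using that by simp
  show ?thesis
  proof (rule that[of a])
    show "a j v \<le> d j v" for j v
      unfolding a_def using card_mono[of "{..<d j v}" "{i \<in> {..<d j v}. (j, v, i) \<in> A}"] by auto
    show "p * (\<Sum>v\<in>X. a j v) < (\<Sum>v\<in>X. d j v) + p \<and> (\<Sum>v\<in>X. d j v) < p * (\<Sum>v\<in>X. a j v) + p"
      if "j \<in> K" "X \<in> L j" for j X
    proof -
      have "finite X" using lam(2)[OF that(1)] that(2) assms(2) by (meson Union_upper finite_subset subset_trans)
      moreover have "H {j} X \<in> F \<union> G" using that unfolding F_def by auto
      ultimately show ?thesis using A[of "H {j} X"] cA[of "{j}" X] cH[of "{j}" X] by simp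
    qed
    show "p * (\<Sum>j\<in>K. a j v) < (\<Sum>j\<in>K. d j v) + p \<and> (\<Sum>j\<in>K. d j v) < p * (\<Sum>j\<in>K. a j v) + p"
      if "v \<in> V" for v
      using A[of "H K {v}"] cA[of K "{v}"] cH[of K "{v}"] assms(1) that unfolding G_def by simp
  qed
qed

section \<open>Components of multigraphs\<close>

definition graph_on :: "'a set \<Rightarrow> 'a medge set \<Rightarrow> bool" where
  "graph_on V E \<longleftrightarrow> (\<forall>e\<in>E. fst e \<subseteq> V \<and> card (fst e) = 2)"

lemma graph_onE:
  assumes "graph_on V E" "e \<in> E"
  obtains u v i where "e = ({u, v}, i)" "u \<noteq> v" "u \<in> V" "v \<in> V"
proof -
  obtain u v where "fst e = {u, v}" "u \<noteq> v"
    using assms unfolding graph_on_def by (meson card_2_iff)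
  then show ?thesis using assms that[of u v "snd e"] unfolding graph_on_def by (metis insert_subset prod.collapse)
qed

lemma graph_on_subset: "graph_on V E \<Longrightarrow> F \<subseteq> E \<Longrightarrow> graph_on V F"
  unfolding graph_on_def by blast

lemma adj_sym: "(u, v) \<in> adj E \<Longrightarrow> (v, u) \<in> adj E"
  unfolding adj_def by (simp add: insert_commute)

lemma sym_adj_rtrancl: "sym ((adj E)\<^sup>*)"
  by (rule sym_rtrancl) (auto intro: symI adj_sym)

lemma adj_vertices: "graph_on V E \<Longrightarrow> (u, v) \<in> adj E \<Longrightarrow> u \<in> V \<and> v \<in> V"
  unfolding adj_def graph_on_def by fastforce

lemma adj_mono: "E \<subseteq> F \<Longrightarrow> adj E \<subseteq> adj F"
  unfolding adj_def by blast

lemma equiv_linked: "equiv V (linked V E)"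
  by (rule equivI)
    (auto simp: linked_def refl_on_def trans_def intro: symI symD[OF sym_adj_rtrancl] rtrancl_trans)

text \<open>Serves to compute the components after adding an edge, isolated vertices or a
  star.\<close>

lemma components_eqI:
  assumes "\<Union>P = V" "{} \<notin> P"
    and conn: "\<And>C u v. C \<in> P \<Longrightarrow> u \<in> C \<Longrightarrow> v \<in> C \<Longrightarrow> (u, v) \<in> (adj E)\<^sup>*"
    and closed: "\<And>C u v. C \<in> P \<Longrightarrow> u \<in> C \<Longrightarrow> (u, v) \<in> adj E \<Longrightarrow> v \<in> C"
  shows "components V E = P"
proof -
  have cl: "v \<in> C" if "(u, v) \<in> (adj E)\<^sup>*" "C \<in> P" "u \<in> C" for C u v
    using that by (induction rule: rtrancl_induct) (auto intro: closed)
  have *: "linked V E `` {u} = C" if "C \<in> P" "u \<in> C" for C u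
    using that cl conn assms(1) unfolding linked_def by blast
  show ?thesis
  proof
    show "components V E \<subseteq> P"
      unfolding components_def quotient_def using * assms(1) by auto
    show "P \<subseteq> components V E"
    proof
      fix C assume C: "C \<in> P"
      then obtain u where u: "u \<in> C" using assms(2) by (metis ex_in_conv)
      then have "u \<in> V" using C assms(1) by blast
      then show "C \<in> components V E"
        using *[OF C u] unfolding components_def by (metis quotientI)
    qed
  qed
qed

lemma Union_components: "\<Union>(components V E) = V"
  unfolding components_def by (rule Union_quotient[OF equiv_linked])

lemma component_subset: "C \<in> components V E \<Longrightarrow> C \<subseteq> V"
  using Union_components[of V E] by blast

lemma component_nonempty: "{} \<notin> components V E"
  unfolding components_def using in_quotient_imp_non_empty[OF equiv_linked] by blast

lemma components_disjoint:
  "C \<in> components V E \<Longrightarrow> D \<in> components V E \<Longrightarrow> C \<noteq> D \<Longrightarrow> C \<inter> D = {}"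
  unfolding components_def using quotient_disj[OF equiv_linked] by blast

lemma finite_components: "finite V \<Longrightarrow> finite (components V E)"
  by (rule finite_subset[of _ "Pow V"]) (auto dest: component_subset)

lemma component_connected:
  "C \<in> components V E \<Longrightarrow> u \<in> C \<Longrightarrow> v \<in> C \<Longrightarrow> (u, v) \<in> (adj E)\<^sup>*"
  unfolding components_def using quotient_eq_iff[OF equiv_linked, of C V E C u v]
  by (auto simp: linked_def)

lemma component_closed:
  assumes "graph_on V E" "C \<in> components V E" "u \<in> C" "(u, v) \<in> adj E"
  shows "v \<in> C"
proof -
  have "(u, v) \<in> linked V E" using assms adj_vertices unfolding linked_def by fastforce
  then show ?thesis
    using assms(2,3) in_quotient_imp_closed[OF equiv_linked] unfolding components_def by metis
qed

lemma sum_components: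
  assumes "finite V"
  shows "(\<Sum>v\<in>V. h v) = (\<Sum>C\<in>components V E. \<Sum>v\<in>C. h v)"
proof -
  have "sum h (\<Union>(components V E)) = (\<Sum>C\<in>components V E. \<Sum>v\<in>C. h v)"
  proof (subst sum.Union_disjoint)
    show "\<forall>C\<in>components V E. finite C" by (meson component_subset assms finite_subset)
    show "\<forall>C\<in>components V E. \<forall>D\<in>components V E. C \<noteq> D \<longrightarrow> C \<inter> D = {}"
      using components_disjoint by blast
  qed simp
  then show ?thesis by (simp add: Union_components)
qed

lemma connected_graph_iff_card_components:
  assumes "finite V" "V \<noteq> {}"
  shows "connected_graph V E \<longleftrightarrow> card (components V E) \<le> 1"
proof
  assume "connected_graph V E"
  then have "(u, v) \<in> (adj E)\<^sup>*" "(u, v) \<in> linked V E" if "u \<in> V" "v \<in> V" for u v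
    using that unfolding connected_graph_def linked_def by auto
  then have "components V E = {V}"
    unfolding components_def quotient_def using assms(2) by (auto simp: linked_def)
  then show "card (components V E) \<le> 1" by simp
next
  assume "card (components V E) \<le> 1"
  then have eq: "C = D" if "C \<in> components V E" "D \<in> components V E" for C D
    using that finite_components[OF assms(1)] by (metis One_nat_def card_le_Suc0_iff_eq)
  have "(u, v) \<in> linked V E" if uv: "u \<in> V" "v \<in> V" for u v
  proof -
    obtain C where "C \<in> components V E" "u \<in> C" "v \<in> C"
      using uv eq Union_components[of V E] by (metis UnionE)
    then show ?thesis using component_connected uv unfolding linked_def by fastforce
  qed
  then show "connected_graph V E" using assms(2) unfolding connected_graph_def by blast
qed

lemma handshake:
  assumes "finite V" "finite E" "graph_on V E"
  shows "(\<Sum>v\<in>V. deg E v) = 2 * card E"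
  unfolding deg_def
proof (rule sum_multicount[OF assms(1,2)], rule ballI)
  fix e assume "e \<in> E"
  then have "{v \<in> V. v \<in> fst e} = fst e" "card (fst e) = 2" using assms(3) unfolding graph_on_def by auto
  then show "card {v \<in> V. v \<in> fst e} = 2" by simp
qed

text \<open>A component is closed under adjacency, so it contains every edge at each of its
  vertices. Hence regularity of a component can be read off from degrees in the whole graph.\<close>

lemma deg_component:
  assumes "graph_on V E" "C \<in> components V E" "v \<in> C"
  shows "deg (induced_edges E C) v = deg E v"
proof -
  have "fst e \<subseteq> C" if e: "e \<in> E" "v \<in> fst e" for e
  proof -
    obtain x y i where xy: "e = ({x, y}, i)" by (rule graph_onE[OF assms(1) e(1)])
    then have "(x, y) \<in> adj E" using e unfolding adj_def by auto
    then show ?thesis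
      using xy e(2) component_closed[OF assms(1,2)] adj_sym assms(3) by fastforce
  qed
  then show ?thesis unfolding deg_def induced_edges_def by (intro arg_cong[where f = card]) auto
qed

text \<open>The new edge merges the components \<open>C\<close> and \<open>D\<close> of its ends and
  affects no others. They may coincide, in which case the number of components does not
  drop.\<close>

lemma card_components_insert:
  assumes "finite V" "graph_on V (insert e E)"
  shows "card (components V E) \<le> card (components V (insert e E)) + 1"
proof -
  have g: "graph_on V E" using assms(2) by (rule graph_on_subset) auto
  obtain x y i where e: "e = ({x, y}, i)" and V: "x \<in> V" "y \<in> V"
    by (rule graph_onE[OF assms(2), of e]) auto
  have adj: "adj (insert e E) = adj E \<union> {(x, y), (y, x)}"
    unfolding adj_def e by (auto simp: doubleton_eq_iff)
  obtain C D where C: "C \<in> components V E" "x \<in> C" and D: "D \<in> components V E" "y \<in> D"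
    using V Union_components by (metis UnionE)
  let ?R = "components V E - {C, D}"
  have mono: "(adj E)\<^sup>* \<subseteq> (adj (insert e E))\<^sup>*" by (intro rtrancl_mono adj_mono) auto
  have x: "(u, x) \<in> (adj (insert e E))\<^sup>*" if "u \<in> C \<union> D" for u
  proof (cases "u \<in> C")
    case True
    then show ?thesis using component_connected[OF C(1) True C(2)] mono by blast
  next
    case False
    then have "(u, y) \<in> (adj (insert e E))\<^sup>*"
      using component_connected[OF D(1) _ D(2), of u] mono that by blast
    moreover have "(y, x) \<in> adj (insert e E)" unfolding adj by simp
    ultimately show ?thesis by (rule rtrancl_into_rtrancl)
  qed
  have "components V (insert e E) = insert (C \<union> D) ?R"
  proof (rule components_eqI)
    show "\<Union>(insert (C \<union> D) ?R) = V"
      using Union_components[of V E] C D by auto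
    show "{} \<notin> insert (C \<union> D) ?R" using C component_nonempty by auto
    show "(u, v) \<in> (adj (insert e E))\<^sup>*" if B: "B \<in> insert (C \<union> D) ?R" "u \<in> B" "v \<in> B" for B u v
    proof (cases "B = C \<union> D")
      case True
      then show ?thesis using x B symD[OF sym_adj_rtrancl] by (meson rtrancl_trans)
    next
      case False
      then show ?thesis using B component_connected[of B V E u v] mono by blast
    qed
    show "v \<in> B" if B: "B \<in> insert (C \<union> D) ?R" "u \<in> B" "(u, v) \<in> adj (insert e E)" for B u v
    proof (cases "(u, v) \<in> adj E")
      case True
      then show ?thesis using B component_closed[OF g] C D by blast
    next
      case False
      then have "u = x \<and> v = y \<or> u = y \<and> v = x" using B(3) unfolding adj by auto
      moreover have "B = C \<union> D"
        using calculation B(1,2) C D components_disjoint by fastforce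
      ultimately show ?thesis using C D by auto
    qed
  qed
  moreover have "C \<union> D \<notin> ?R" using C(1,2) components_disjoint by fastforce
  moreover have fin: "finite (components V E)" by (rule finite_components[OF assms(1)])
  ultimately have "card (components V (insert e E)) = Suc (card ?R)" by simp
  moreover have "card (components V E) \<le> card ?R + card {C, D}"
    using card_Un_le[of ?R "{C, D}"] C D card_mono[of "?R \<union> {C, D}" "components V E"] fin by fastforce
  moreover have "card {C, D} \<le> 2" by (simp add: card_insert_if)
  ultimately show ?thesis by linarith
qed

lemma card_components_Un:
  assumes "finite V" "finite F" "graph_on V (E \<union> F)"
  shows "card (components V E) \<le> card (components V (E \<union> F)) + card F"
  using assms(2,3)
proof (induction F)
  case empty
  then show ?case by simp
next
  case (insert e F)
  then have "card (components V E) \<le> card (components V (E \<union> F)) + card F"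
    by (intro insert.IH) (auto intro: graph_on_subset)
  moreover have "card (components V (E \<union> F)) \<le> card (components V (insert e (E \<union> F))) + 1"
    using card_components_insert[OF assms(1)] insert.prems by simp
  ultimately show ?case using insert.hyps by simp
qed

lemma components_isolated:
  assumes "graph_on V E" "V \<subseteq> W"
  shows "components W E = components V E \<union> (\<lambda>w. {w}) ` (W - V)"
proof (rule components_eqI)
  show "\<Union>(components V E \<union> (\<lambda>w. {w}) ` (W - V)) = W"
    using assms(2) Union_components[of V E] by auto
  show "{} \<notin> components V E \<union> (\<lambda>w. {w}) ` (W - V)"
    using component_nonempty[of V E] by auto
  show "(u, v) \<in> (adj E)\<^sup>*" if "C \<in> components V E \<union> (\<lambda>w. {w}) ` (W - V)" "u \<in> C" "v \<in> C" for C u v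
    using that component_connected by fastforce
  show "v \<in> C" if "C \<in> components V E \<union> (\<lambda>w. {w}) ` (W - V)" "u \<in> C" "(u, v) \<in> adj E" for C u v
    using that component_closed[OF assms(1)] adj_vertices[OF assms(1)] by fastforce
qed

lemma card_components_isolated:
  assumes "graph_on V E" "V \<subseteq> W" "finite W"
  shows "card (components W E) = card (components V E) + card (W - V)"
proof -
  have "components V E \<inter> (\<lambda>w. {w}) ` (W - V) = {}"
    using component_subset by fastforce
  moreover have "card ((\<lambda>w. {w}) ` (W - V)) = card (W - V)" by (rule card_image) (auto simp: inj_on_def)
  ultimately show ?thesis
    unfolding components_isolated[OF assms(1,2)]
    using finite_components finite_subset[OF assms(2,3)] assms(3) by (subst card_Un_disjoint) auto
qed

section \<open>Attaching a new vertex by a bundle of edges\<close>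

definition star :: "'a \<Rightarrow> ('a \<times> nat) set \<Rightarrow> 'a medge set" where
  "star w T = (\<lambda>(v, i). ({v, w}, i)) ` T"

context
  fixes V :: "'a set" and E :: "'a medge set" and w :: 'a and T :: "('a \<times> nat) set"
  assumes V: "finite V" "w \<notin> V" and E: "finite E" "graph_on V E"
    and T: "finite T" "fst ` T \<subseteq> V"
begin

lemma inj_on_star: "inj_on (\<lambda>(v, i). ({v, w}, i)) T"
  using V(2) T(2) by (fastforce simp: inj_on_def doubleton_eq_iff)

lemma star_disjoint: "E \<inter> star w T = {}"
  using E(2) V(2) unfolding graph_on_def star_def by fastforce

lemma card_Un_star: "card (E \<union> star w T) = card E + card T"
  using star_disjoint E T card_image[OF inj_on_star]
  by (subst card_Un_disjoint) (auto simp: star_def)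

lemma deg_Un_star:
  assumes "v \<in> V"
  shows "deg (E \<union> star w T) v = deg E v + card {i. (v, i) \<in> T}"
proof -
  have "{e \<in> star w T. v \<in> fst e} = Pair {v, w} ` {i. (v, i) \<in> T}"
    using assms V(2) unfolding star_def by force
  then have "card {e \<in> star w T. v \<in> fst e} = card {i. (v, i) \<in> T}"
    by (simp add: card_image inj_on_def)
  moreover have "{e \<in> E \<union> star w T. v \<in> fst e} = {e \<in> E. v \<in> fst e} \<union> {e \<in> star w T. v \<in> fst e}"
    by auto
  moreover have "finite (star w T)" using T unfolding star_def by simp
  ultimately show ?thesis
    unfolding deg_def using star_disjoint E(1)
    by (simp add: card_Un_disjoint disjoint_iff)
qed

lemma deg_Un_star_centre: "deg (E \<union> star w T) w = card T"
proof -
  have "{e \<in> E \<union> star w T. w \<in> fst e} = star w T"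
    using E(2) V(2) unfolding star_def graph_on_def by fastforce
  then show ?thesis unfolding deg_def star_def using card_image[OF inj_on_star] by simp
qed

lemma adj_Un_star:
  "adj (E \<union> star w T) = adj E \<union> (\<lambda>v. (v, w)) ` fst ` T \<union> Pair w ` fst ` T"
  unfolding adj_def star_def by (fastforce simp: doubleton_eq_iff image_iff)

text \<open>The new vertex glues together exactly the components that receive an edge; all others
  survive unchanged.\<close>

lemma components_Un_star:
  "components (insert w V) (E \<union> star w T) =
    insert (insert w (\<Union>{C \<in> components V E. C \<inter> fst ` T \<noteq> {}}))
      {C \<in> components V E. C \<inter> fst ` T = {}}"
    (is "_ = insert (insert w ?X) ?R")
proof (rule components_eqI)
  let ?A = "adj (E \<union> star w T)"
  have mono: "(adj E)\<^sup>* \<subseteq> ?A\<^sup>*" by (intro rtrancl_mono adj_mono) auto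
  show "\<Union>(insert (insert w ?X) ?R) = insert w V"
  proof -
    have "{C \<in> components V E. C \<inter> fst ` T \<noteq> {}} \<union> ?R = components V E" by auto
    then have "?X \<union> \<Union>?R = V" by (metis Union_Un_distrib Union_components)
    then show ?thesis by auto
  qed
  show "{} \<notin> insert (insert w ?X) ?R" using component_nonempty[of V E] by auto
  have w: "(u, w) \<in> ?A\<^sup>*" if u: "u \<in> insert w ?X" for u
  proof (cases "u = w")
    case False
    then obtain C v where C: "C \<in> components V E" "u \<in> C" "v \<in> C" "v \<in> fst ` T" using u by blast
    then have "(u, v) \<in> ?A\<^sup>*" using component_connected[of C V E u v] mono by blast
    moreover have "(v, w) \<in> ?A" using C(4) unfolding adj_Un_star by auto
    ultimately show ?thesis by (rule rtrancl_into_rtrancl)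
  qed simp
  show "(u, v) \<in> ?A\<^sup>*" if C: "C \<in> insert (insert w ?X) ?R" "u \<in> C" "v \<in> C" for C u v
  proof (cases "C \<in> ?R")
    case True
    then show ?thesis using component_connected[of C V E u v] C mono by blast
  next
    case False
    then have "(u, w) \<in> ?A\<^sup>*" "(v, w) \<in> ?A\<^sup>*" using C w by auto
    then show ?thesis using symD[OF sym_adj_rtrancl] by (meson rtrancl_trans)
  qed
  show "v \<in> C" if C: "C \<in> insert (insert w ?X) ?R" "u \<in> C" "(u, v) \<in> ?A" for C u v
  proof -
    have adjE: "v \<in> D" if "D \<in> components V E" "u \<in> D" "(u, v) \<in> adj E" for D
      using component_closed[OF E(2)] that by blast
    have wV: "(u, v) \<notin> adj E" if "u = w" using adj_vertices[OF E(2)] V(2) that by blast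
    consider "(u, v) \<in> adj E" | "v = w" "u \<in> fst ` T" | "u = w" "v \<in> fst ` T"
      using C(3) unfolding adj_Un_star by auto
    then show ?thesis
    proof cases
      case 1
      then show ?thesis using C adjE wV by blast
    next
      case 2
      then show ?thesis using C by blast
    next
      case 3
      then have "C = insert w ?X" using C V(2) component_subset by fastforce
      moreover have "v \<in> V" using 3 T(2) by blast
      ultimately show ?thesis using 3 Union_components[of V E] by blast
    qed
  qed
qed

end

section \<open>Complete multigraphs and their colour classes\<close>

lemma graph_on_lamK: "graph_on {..<n} (lamK lam n)"
  unfolding graph_on_def lamK_def by auto

lemma finite_lamK: "finite (lamK lam n)"
  by (rule finite_subset[of _ "Pow {..<n} \<times> {..<lam}"]) (auto simp: lamK_def)

lemma lamK_mono: "m \<le> n \<Longrightarrow> lamK lam m \<subseteq> lamK lam n"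
  unfolding lamK_def by (auto dest: lessThan_subset_iff[THEN iffD2])

lemma graph_on_colour_class: "graph_on {..<n} (colour_class (lamK lam n) f j)"
  by (rule graph_on_subset[OF graph_on_lamK]) (auto simp: colour_class_def)

lemma finite_colour_class: "finite E \<Longrightarrow> finite (colour_class E f j)"
  unfolding colour_class_def by simp

lemma deg_lamK:
  assumes "v < n"
  shows "deg (lamK lam n) v = lam * (n - 1)"
proof -
  have "{e \<in> lamK lam n. v \<in> fst e} = (\<lambda>(u, i). ({v, u}, i)) ` (({..<n} - {v}) \<times> {..<lam})"
    (is "?L = ?f ` ?R")
  proof
    show "?L \<subseteq> ?f ` ?R"
    proof
      fix e assume e: "e \<in> ?L"
      then obtain x y i where "e = ({x, y}, i)" "x \<noteq> y" "x \<in> {..<n}" "y \<in> {..<n}"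
        using graph_onE[OF graph_on_lamK, of e] by blast
      moreover have "i < lam" "v = x \<or> v = y" using e calculation unfolding lamK_def by auto
      ultimately show "e \<in> ?f ` ?R" by (auto simp: insert_commute image_iff)
    qed
    show "?f ` ?R \<subseteq> ?L" using assms unfolding lamK_def by auto
  qed
  moreover have "inj_on ?f ?R" by (auto simp: inj_on_def doubleton_eq_iff)
  ultimately show ?thesis unfolding deg_def using assms by (simp add: card_image card_cartesian_product)
qed

lemma sum_deg_colour_class:
  assumes "finite K" "finite E" "\<And>e. e \<in> E \<Longrightarrow> f e \<in> K"
  shows "(\<Sum>j\<in>K. deg (colour_class E f j) v) = deg E v"
proof -
  have "deg E v = card (\<Union>j\<in>K. {e \<in> colour_class E f j. v \<in> fst e})"
    unfolding deg_def colour_class_def using assms(3) by (intro arg_cong[where f = card]) auto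
  also have "\<dots> = (\<Sum>j\<in>K. deg (colour_class E f j) v)"
    unfolding deg_def using assms(1,2) by (intro card_UN_disjoint) (auto simp: colour_class_def)
  finally show ?thesis by simp
qed

lemma lamK_Suc: "lamK lam (Suc M) = lamK lam M \<union> star M ({..<M} \<times> {..<lam})"
proof
  show "lamK lam (Suc M) \<subseteq> lamK lam M \<union> star M ({..<M} \<times> {..<lam})"
  proof
    fix e assume e: "e \<in> lamK lam (Suc M)"
    then obtain x y i where *: "e = ({x, y}, i)" "x \<noteq> y" "x \<le> M" "y \<le> M"
      using graph_onE[OF graph_on_lamK e] by (metis lessThan_iff less_Suc_eq_le)
    moreover have "i < lam" using e * unfolding lamK_def by auto
    ultimately show "e \<in> lamK lam M \<union> star M ({..<M} \<times> {..<lam})"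
      by (cases "x = M"; cases "y = M") (auto simp: lamK_def star_def insert_commute image_iff)
  qed
  show "lamK lam M \<union> star M ({..<M} \<times> {..<lam}) \<subseteq> lamK lam (Suc M)"
    unfolding lamK_def star_def by auto
qed

section \<open>Adding a vertex\<close>

text \<open>Will distribute the parallel edges between an old vertex and the new one among the
  colours, with a prescribed number for each colour. A bijection onto a disjoint union of sets of
  these sizes provides the map.\<close>

lemma exists_map_with_fibre_cards:
  fixes a :: "'j \<Rightarrow> nat"
  assumes "finite K" "(\<Sum>j\<in>K. a j) = l"
  shows "\<exists>h :: nat \<Rightarrow> 'j. (\<forall>i<l. h i \<in> K) \<and> (\<forall>j\<in>K. card {i. i < l \<and> h i = j} = a j)"
proof -
  let ?S = "SIGMA j:K. {..<a j}"
  have "card ?S = card {..<l}" using assms by simp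
  then obtain b where b: "bij_betw b {..<l} ?S"
    using finite_same_card_bij[of "{..<l}" ?S] assms(1) by auto
  have mem: "b i \<in> ?S" if "i < l" for i using b that by (auto dest: bij_betwE)
  have "card {i. i < l \<and> fst (b i) = j} = a j" if j: "j \<in> K" for j
  proof -
    have "b ` {i. i < l \<and> fst (b i) = j} = {j} \<times> {..<a j}"
    proof
      show "b ` {i. i < l \<and> fst (b i) = j} \<subseteq> {j} \<times> {..<a j}" using mem by fastforce
      show "{j} \<times> {..<a j} \<subseteq> b ` {i. i < l \<and> fst (b i) = j}"
      proof
        fix s assume s: "s \<in> {j} \<times> {..<a j}"
        then have "s \<in> b ` {..<l}" using b j unfolding bij_betw_def by auto
        then obtain i where "i < l" "s = b i" by auto
        then show "s \<in> b ` {i. i < l \<and> fst (b i) = j}" using s by (intro image_eqI[of _ _ i]) auto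
      qed
    qed
    moreover have "inj_on b {i. i < l \<and> fst (b i) = j}"
      using b unfolding bij_betw_def by (auto intro: inj_on_subset)
    ultimately show ?thesis
      using card_image[of b "{i. i < l \<and> fst (b i) = j}"] by (simp add: card_cartesian_product)
  qed
  moreover have "fst (b i) \<in> K" if "i < l" for i using mem[OF that] by auto
  ultimately show ?thesis by (intro exI[of _ "fst \<circ> b"]) simp
qed

text \<open>The first hypothesis says that \<open>a\<close> is at most \<open>d / p\<close> rounded
  up. The first two bounds control the number of components, the third keeps an edge of a touched
  component in reserve, and the fourth keeps the number of remaining loops nonnegative.\<close>

lemma fair_share_bounds:
  fixes a d p :: nat
  assumes "p * a < d + p" "0 < d" "a \<le> d"
  shows "p \<le> d \<Longrightarrow> a + (p - 1) \<le> d"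
    and "d < p \<Longrightarrow> a \<le> 1"
    and "2 \<le> p \<Longrightarrow> 2 \<le> d \<Longrightarrow> a < d"
    and "2 \<le> p \<Longrightarrow> even d \<Longrightarrow> 2 * a \<le> d"
proof -
  show "a + (p - 1) \<le> d" if "p \<le> d"
  proof (cases "a \<le> 1")
    case True
    then show ?thesis using that assms(2) by linarith
  next
    case False
    then obtain b where b: "a = 2 + b" using le_Suc_ex[of 2 a] by auto
    show ?thesis
    proof (cases p)
      case (Suc q)
      have "a + q \<le> d"
        using assms(1) unfolding b Suc by (cases q) (auto simp: algebra_simps)
      then show ?thesis using Suc by simp
    qed (use assms in simp)
  qed
  show "a \<le> 1" if "d < p"
  proof (rule ccontr)
    assume "\<not> a \<le> 1"
    then have "p * 2 \<le> p * a" by (intro mult_le_mono2) simp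
    then show False using assms(1) that by linarith
  qed
  show "a < d" if pd: "2 \<le> p" "2 \<le> d"
  proof (rule ccontr)
    assume "\<not> a < d"
    then have "a = d" using assms(3) by simp
    moreover obtain q where "p = q + 2" using pd by (metis add.commute le_iff_add)
    moreover obtain b where "d = b + 2" using pd by (metis add.commute le_iff_add)
    ultimately show False using assms(1) by (simp add: algebra_simps)
  qed
  show "2 * a \<le> d" if p: "2 \<le> p" and "even d"
  proof (cases a)
    case (Suc b)
    obtain q where q: "p = q + 2" using p by (metis add.commute le_iff_add)
    have "2 * a < d + 2" using assms(1) unfolding Suc q by (simp add: algebra_simps)
    then show ?thesis using \<open>even d\<close> by presburger
  qed simp
qed

text \<open>A component costs \<open>h D\<close>: its new edges, or 1 if it stays separate, and this
  never exceeds \<open>\<delta> D\<close>. If some component has at least \<open>p\<close> edges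
  available, it alone saves \<open>p - 1\<close>. Otherwise every component costs exactly 1 and the
  hypothesis is the claim.\<close>

lemma component_count_bound:
  fixes \<delta> a :: "'c \<Rightarrow> nat"
  assumes "finite \<D>" and D: "\<And>D. D \<in> \<D> \<Longrightarrow> 0 < \<delta> D \<and> a D \<le> \<delta> D \<and> p * a D < \<delta> D + p"
    and "2 * card \<D> + 2 * p \<le> 2 * (\<Sum>D\<in>\<D>. \<delta> D) + l + 2"
  shows "2 * (\<Sum>D\<in>\<D>. a D) + 2 * card {D \<in> \<D>. a D = 0} + 2 * p \<le> 2 * (\<Sum>D\<in>\<D>. \<delta> D) + l + 2"
proof -
  define h where "h D = a D + (if a D = 0 then 1 else 0)" for D
  have h: "(\<Sum>D\<in>\<D>. h D) = (\<Sum>D\<in>\<D>. a D) + card {D \<in> \<D>. a D = 0}"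
    unfolding h_def using assms(1) by (simp add: sum.distrib sum.If_cases Int_def)
  have le: "h D \<le> \<delta> D" if "D \<in> \<D>" for D
    using D[OF that] unfolding h_def by auto
  show ?thesis
  proof (cases "\<exists>D\<in>\<D>. p \<le> \<delta> D")
    case True
    then obtain C where C: "C \<in> \<D>" "p \<le> \<delta> C" by blast
    have "h C + (p - 1) \<le> \<delta> C"
      using fair_share_bounds(1)[of p "a C" "\<delta> C"] D[OF C(1)] C(2) unfolding h_def by auto
    moreover have "(\<Sum>D\<in>\<D> - {C}. h D) \<le> (\<Sum>D\<in>\<D> - {C}. \<delta> D)" by (intro sum_mono le) auto
    ultimately have "(\<Sum>D\<in>\<D>. h D) + (p - 1) \<le> (\<Sum>D\<in>\<D>. \<delta> D)"
      using C(1) assms(1) by (simp add: sum.remove)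
    then show ?thesis using h by linarith
  next
    case False
    then have "h D = 1" if "D \<in> \<D>" for D
      using fair_share_bounds(2)[of p "a D" "\<delta> D"] D[OF that] that unfolding h_def by fastforce
    then have "(\<Sum>D\<in>\<D>. h D) = card \<D>" by simp
    then show ?thesis using h assms(3) by linarith
  qed
qed

text \<open>Rounding is exact when the total is a multiple of \<open>p\<close>; this makes degrees
  and multiplicities at the new vertex come out right.\<close>

lemma fair_sum_eq:
  fixes p q s :: nat
  assumes "p * s < p * q + p" "p * q < p * s + p"
  shows "s = q"
proof -
  have "p * s < p * Suc q" "p * q < p * Suc s" using assms by (simp_all add: algebra_simps)
  then have "s < Suc q" "q < Suc s" by (simp_all only: mult_less_cancel1)
  then show ?thesis by simp
qed

text \<open>
  Think of the vertices outside \<open>{..<M}\<close> as amalgamated into one vertex. In colour \<open>j\<close> the vertex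
  \<open>v < M\<close> sends \<open>r - deg v\<close> edges to it, and \<open>(r n + 2 e) div 2 - r M\<close> loops remain there,
  where \<open>e\<close> is the number of edges of colour \<open>j\<close>. The conditions say that no component is cut off
  from the amalgamated vertex, that the number of loops is nonnegative, and that there are enough
  edges to make the final colour class connected.
\<close>

definition extendable :: "nat \<Rightarrow> nat \<Rightarrow> nat \<Rightarrow> nat \<Rightarrow> (nat medge \<Rightarrow> nat) \<Rightarrow> bool" where
  "extendable n r lam M f \<longleftrightarrow> partial_factorization n r lam M f \<and>
     (\<forall>j\<in>colours n r lam.
        2 * (card (colour_class (lamK lam M) f j) +
             card (components {..<M} (colour_class (lamK lam M) f j))) + 2 * n \<le> r * n + 2 * M + 2) \<and>
     (M < n \<longrightarrow> (\<forall>j\<in>colours n r lam.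
        (\<forall>C\<in>components {..<M} (colour_class (lamK lam M) f j).
           \<exists>v\<in>C. deg (colour_class (lamK lam M) f j) v < r) \<and>
        2 * r * M \<le> r * n + 2 * card (colour_class (lamK lam M) f j)))"

lemma finite_colours: "finite (colours n r lam)"
  unfolding colours_def by simp

lemma sum_deg_colours:
  assumes "\<forall>e\<in>lamK lam M. f e \<in> colours n r lam" "v < M"
  shows "(\<Sum>j\<in>colours n r lam. deg (colour_class (lamK lam M) f j) v) = lam * (M - 1)"
  using sum_deg_colour_class[OF finite_colours finite_lamK] assms deg_lamK by simp

lemma extendable_Suc:
  assumes adm: "two_admissible n r lam" and Mn: "M < n" and ext: "extendable n r lam M f"
  shows "\<exists>f'. (\<forall>e\<in>lamK lam M. f' e = f e) \<and> extendable n r lam (Suc M) f'"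
proof -
  define K where "K = colours n r lam"
  define G where "G j = colour_class (lamK lam M) f j" for j
  define \<D> where "\<D> j = components {..<M} (G j)" for j
  define p where "p = n - M"
  define d where "d j v = (if v = M then r * n + 2 * card (G j) - 2 * r * M else r - deg (G j) v)" for j v
  \<comment> \<open>\<open>d j v\<close> counts half-edges at the amalgamated vertex \<open>M\<close>, so each loop contributes 2 to \<open>d j M\<close>\<close>
  define \<delta> where "\<delta> j D = (\<Sum>v\<in>D. d j v)" for j D
  define B where "B j = insert M (\<Union>{D \<in> \<D> j. 2 \<le> \<delta> j D})" for j
  \<comment> \<open>The whole set fixes the degree of the new vertex, \<open>{M}\<close> limits its
    use of loops, the components control how many of them merge and how many edges they lose, and
    \<open>B j\<close> guarantees spare degree in the merged component.\<close>
  define L where "L j = {{..<Suc M}, B j, {M}} \<union> \<D> j" for j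
  have pf: "\<forall>e\<in>lamK lam M. f e \<in> K" and degr: "\<And>j v. j \<in> K \<Longrightarrow> v < M \<Longrightarrow> deg (G j) v \<le> r"
    using ext unfolding extendable_def partial_factorization_def K_def G_def by auto
  have up: "2 * (card (G j) + card (\<D> j)) + 2 * n \<le> r * n + 2 * M + 2" if "j \<in> K" for j
    using ext that unfolding extendable_def K_def G_def \<D>_def by auto
  have defic: "\<exists>v\<in>C. deg (G j) v < r" if "j \<in> K" "C \<in> \<D> j" for j C
    using ext that Mn unfolding extendable_def K_def G_def \<D>_def by auto
  have lo: "2 * r * M \<le> r * n + 2 * card (G j)" if "j \<in> K" for j
    using ext that Mn unfolding extendable_def K_def G_def by auto
  have finK: "finite K" unfolding K_def by (rule finite_colours)
  have gG: "graph_on {..<M} (G j)" for j unfolding G_def by (rule graph_on_colour_class)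
  have fG: "finite (G j)" for j unfolding G_def by (intro finite_colour_class finite_lamK)
  have fD: "finite (\<D> j)" for j unfolding \<D>_def by (intro finite_components) simp
  have subD: "D \<subseteq> {..<M}" if "D \<in> \<D> j" for D j using that component_subset unfolding \<D>_def by blast
  have p: "p > 0" "n = M + p" using Mn unfolding p_def by auto
  have kr: "r * card K = lam * (n - 1)"
    using adm unfolding two_admissible_def K_def colours_def by simp
  \<comment> \<open>The three special sets form a chain, and each component lies inside or avoids
    each of them.\<close>
  have "laminar (L j)" for j
  proof -
    let ?N = "{{..<Suc M}, B j, {M}}"
    have chain: "P \<subseteq> Q \<or> Q \<subseteq> P" if "P \<in> ?N" "Q \<in> ?N" for P Q
    proof -
      have "B j \<subseteq> {..<Suc M}" using subD unfolding B_def by (fastforce simp: less_Suc_eq)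
      moreover have "{M} \<subseteq> B j" unfolding B_def by simp
      ultimately show ?thesis using that by fastforce
    qed
    have comp: "D \<subseteq> P \<or> D \<inter> P = {}" if D: "D \<in> \<D> j" and P: "P \<in> ?N" for D P
    proof -
      have "D \<subseteq> B j \<or> D \<inter> B j = {}"
      proof (cases "2 \<le> \<delta> j D")
        case True
        then show ?thesis using D unfolding B_def by blast
      next
        case False
        then have "D \<inter> C = {}" if "C \<in> \<D> j" "2 \<le> \<delta> j C" for C
          using components_disjoint D that unfolding \<D>_def by metis
        then show ?thesis using subD[OF D] unfolding B_def by fastforce
      qed
      moreover have "D \<subseteq> {..<Suc M}" "D \<inter> {M} = {}" using subD[OF D] by (auto simp: less_Suc_eq)
      ultimately show ?thesis using P by blast
    qed
    have comps: "C \<subseteq> D \<or> C \<inter> D = {}" if "C \<in> \<D> j" "D \<in> \<D> j" for C D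
      using components_disjoint[of C "{..<M}" "G j" D] that unfolding \<D>_def by auto
    show ?thesis
      unfolding laminar_def
    proof (intro ballI)
      fix P Q assume "P \<in> L j" "Q \<in> L j"
      then consider "P \<in> ?N" "Q \<in> ?N" | "P \<in> ?N" "Q \<in> \<D> j" | "P \<in> \<D> j" "Q \<in> ?N"
        | "P \<in> \<D> j" "Q \<in> \<D> j" unfolding L_def Un_iff by argo
      then show "P \<subseteq> Q \<or> Q \<subseteq> P \<or> P \<inter> Q = {}"
      proof cases
        case 1 then show ?thesis using chain by metis
      next
        case 2 then show ?thesis using comp[of Q P] by (metis inf_commute)
      next
        case 3 then show ?thesis using comp[of P Q] by metis
      next
        case 4 then show ?thesis using comps[of P Q] by metis
      qed
    qed
  qed
  moreover have "\<Union>(L j) \<subseteq> {..<Suc M}" for j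
    using subD unfolding L_def B_def by (fastforce simp: less_Suc_eq)
  \<comment> \<open>For \<open>v < M\<close>, \<open>a j v\<close> is the number of edges of colour
    \<open>j\<close> from \<open>v\<close> to the new vertex; \<open>a j M\<close> is the number of
    edges from the new vertex to the vertices still amalgamated.\<close>
  ultimately obtain a where ale: "\<And>j v. a j v \<le> d j v"
    and aL: "\<And>j X. j \<in> K \<Longrightarrow> X \<in> L j \<Longrightarrow> p * (\<Sum>v\<in>X. a j v) < (\<Sum>v\<in>X. d j v) + p \<and>
      (\<Sum>v\<in>X. d j v) < p * (\<Sum>v\<in>X. a j v) + p"
    and aV: "\<And>v. v \<in> {..<Suc M} \<Longrightarrow> p * (\<Sum>j\<in>K. a j v) < (\<Sum>j\<in>K. d j v) + p \<and>
      (\<Sum>j\<in>K. d j v) < p * (\<Sum>j\<in>K. a j v) + p"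
    using fair_rounding[OF finK, of "{..<Suc M}" p L d] p(1) by blast
  have sumd: "(\<Sum>v<M. d j v) + 2 * card (G j) = r * M" if "j \<in> K" for j
  proof -
    have "(\<Sum>v<M. d j v) + (\<Sum>v<M. deg (G j) v) = (\<Sum>v<M. r)"
      unfolding sum.distrib[symmetric] using degr[OF that] by (intro sum.cong) (auto simp: d_def)
    then show ?thesis using handshake[OF _ fG gG] by simp
  qed
  \<comment> \<open>The amalgamated vertex has total degree \<open>p * r\<close> in each colour, so
    the share of the new vertex is exactly \<open>r\<close>.\<close>
  have suma: "(\<Sum>v<M. a j v) + a j M = r" if j: "j \<in> K" for j
  proof -
    have "(\<Sum>v<Suc M. d j v) + 2 * r * M = r * M + r * n"
      using sumd[OF j] lo[OF j] by (simp add: d_def)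
    then have "(\<Sum>v<Suc M. d j v) = p * r" using p(2) by (simp add: algebra_simps)
    then have "(\<Sum>v<Suc M. a j v) = r"
      using aL[OF j, of "{..<Suc M}"] fair_sum_eq[of p "\<Sum>v<Suc M. a j v" r] unfolding L_def by simp
    then show ?thesis by simp
  qed
  \<comment> \<open>Over all colours, \<open>v\<close> still misses \<open>lam\<close> edges to each
    of the \<open>p\<close> amalgamated vertices, so exactly \<open>lam\<close> of them go to the
    new one. Here \<open>r * card K = lam * (n - 1)\<close> enters.\<close>
  have sumav: "(\<Sum>j\<in>K. a j v) = lam" if v: "v < M" for v
  proof -
    have "(\<Sum>j\<in>K. d j v) + (\<Sum>j\<in>K. deg (G j) v) = (\<Sum>j\<in>K. r)"
      unfolding sum.distrib[symmetric] using degr v by (intro sum.cong) (auto simp: d_def)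
    moreover have "(\<Sum>j\<in>K. deg (G j) v) = lam * (M - 1)"
      using sum_deg_colours[of lam M f n r v] pf v unfolding K_def G_def by simp
    ultimately have "(\<Sum>j\<in>K. d j v) + lam * (M - 1) = lam * (n - 1)" using kr by (simp add: mult.commute)
    moreover have "lam * (n - 1) = lam * (M - 1) + p * lam"
      using v p(2) by (simp add: algebra_simps diff_mult_distrib2[symmetric] flip: add_mult_distrib2)
    ultimately have "(\<Sum>j\<in>K. d j v) = p * lam" by linarith
    then show ?thesis using aV[of v] fair_sum_eq[of p "\<Sum>j\<in>K. a j v" lam] v by simp
  qed
  have "\<forall>v. \<exists>h. v < M \<longrightarrow> (\<forall>i<lam. h i \<in> K) \<and> (\<forall>j\<in>K. card {i. i < lam \<and> h i = j} = a j v)"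
    using exists_map_with_fibre_cards[OF finK sumav] by blast
  then obtain g where g: "\<And>v i. v < M \<Longrightarrow> i < lam \<Longrightarrow> g v i \<in> K"
    "\<And>v j. v < M \<Longrightarrow> j \<in> K \<Longrightarrow> card {i. i < lam \<and> g v i = j} = a j v"
    by metis
  \<comment> \<open>On an edge between \<open>v < M\<close> and \<open>M\<close>, the minimum
    recovers \<open>v\<close>; the edge index selects the colour through \<open>g v\<close>.\<close>
  define f' where "f' e = (if M \<in> fst e then g (Min (fst e)) (snd e) else f e)" for e
  have f'old: "f' e = f e" if "e \<in> lamK lam M" for e
    using that unfolding f'_def lamK_def by auto
  have f'new: "f' ({v, M}, i) = g v i" if "v < M" for v i
    using that unfolding f'_def by simp
  define T where "T j = (SIGMA v:{..<M}. {i. i < lam \<and> g v i = j})" for j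
  define G' where "G' j = colour_class (lamK lam (Suc M)) f' j" for j
  have G': "G' j = G j \<union> star M (T j)" for j
    unfolding G'_def G_def lamK_Suc colour_class_def star_def T_def using f'old f'new
    by (auto simp: image_iff)
  have T: "finite (T j)" "fst ` T j \<subseteq> {..<M}" for j unfolding T_def by auto
  note star = finite_lessThan[of M] less_irrefl[of M, folded lessThan_iff] fG gG T
  have Tv: "card {i. (v, i) \<in> T j} = a j v" if "v < M" "j \<in> K" for v j
    using g(2)[OF that] that unfolding T_def by simp
  have cT: "card (T j) = (\<Sum>v<M. a j v)" if "j \<in> K" for j
    unfolding T_def using g(2) that by simp
  have degv: "deg (G' j) v = deg (G j) v + a j v" if "v < M" "j \<in> K" for v j
    unfolding G' using deg_Un_star[OF star, of v] Tv that by simp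
  have degM: "deg (G' j) M = (\<Sum>v<M. a j v)" if "j \<in> K" for j
    unfolding G' using deg_Un_star_centre[OF star] cT that by simp
  have cG': "card (G' j) = card (G j) + (\<Sum>v<M. a j v)" if "j \<in> K" for j
    unfolding G' using card_Un_star[OF star] cT that by simp
  have degv_le: "deg (G' j) v < r \<longleftrightarrow> a j v < d j v" "deg (G' j) v \<le> r" if "v < M" "j \<in> K" for v j
    using degv[OF that] ale[of j v] degr[OF that(2,1)] that unfolding d_def by auto
  define \<alpha> where "\<alpha> j D = (\<Sum>v\<in>D. a j v)" for j D
  have fin: "finite D" if "D \<in> \<D> j" for j D using subD[OF that] finite_subset by blast
  have fstT: "v \<in> fst ` T j \<longleftrightarrow> 0 < a j v" if "v < M" "j \<in> K" for v j
  proof -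
    have "v \<in> fst ` T j \<longleftrightarrow> {i. i < lam \<and> g v i = j} \<noteq> {}" using that unfolding T_def by force
    then show ?thesis using g(2)[OF that] card_gt_0_iff[of "{i. i < lam \<and> g v i = j}"] by simp
  qed
  have untouched: "D \<inter> fst ` T j = {} \<longleftrightarrow> \<alpha> j D = 0" if "D \<in> \<D> j" "j \<in> K" for j D
  proof -
    have "v \<in> fst ` T j \<longleftrightarrow> a j v \<noteq> 0" if v: "v \<in> D" for v
      using fstT[of v j] subD[OF \<open>D \<in> \<D> j\<close>] v \<open>j \<in> K\<close> by auto
    then show ?thesis using fin[OF that(1)] unfolding \<alpha>_def by (auto simp: disjoint_iff)
  qed
  \<comment> \<open>The component of the new vertex: it swallows the components that send it an
    edge.\<close>
  define X where "X j = insert M (\<Union>{D \<in> \<D> j. \<alpha> j D \<noteq> 0})" for j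
  have comps: "components {..<Suc M} (G' j) = insert (X j) {D \<in> \<D> j. \<alpha> j D = 0}" if "j \<in> K" for j
  proof -
    have "{D \<in> \<D> j. D \<inter> fst ` T j = {}} = {D \<in> \<D> j. \<alpha> j D = 0}"
      "{D \<in> \<D> j. D \<inter> fst ` T j \<noteq> {}} = {D \<in> \<D> j. \<alpha> j D \<noteq> 0}"
      using untouched that by auto
    then show ?thesis
      unfolding G' lessThan_Suc components_Un_star[OF star] X_def \<D>_def[symmetric] by simp
  qed
  have \<delta>pos: "0 < \<delta> j D" if j: "j \<in> K" and D: "D \<in> \<D> j" for j D
  proof -
    obtain v where v: "v \<in> D" "deg (G j) v < r" using defic[OF j D] by blast
    then have "v \<noteq> M" using subD[OF D] by auto
    then have "0 < d j v" using v unfolding d_def by simp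
    then show ?thesis unfolding \<delta>_def using v(1) fin[OF D] by (simp add: sum_pos2)
  qed
  have \<alpha>\<delta>: "0 < \<delta> j D \<and> \<alpha> j D \<le> \<delta> j D \<and> p * \<alpha> j D < \<delta> j D + p" if j: "j \<in> K" and D: "D \<in> \<D> j" for j D
    using \<delta>pos[OF j D] aL[OF j, of D] D ale unfolding \<alpha>_def \<delta>_def L_def by (auto intro: sum_mono)
  have sum\<D>: "(\<Sum>v<M. h v) = (\<Sum>D\<in>\<D> j. \<Sum>v\<in>D. h v)" for h :: "nat \<Rightarrow> nat" and j
    unfolding \<D>_def by (rule sum_components) simp
  have dM: "d j M + 2 * r * M = r * n + 2 * card (G j)" if "j \<in> K" for j
    unfolding d_def using lo[OF that] by simp
  \<comment> \<open>This is the upper bound on the number of edges, seen from the amalgamated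
    vertex: the edges still to come, \<open>\<delta>\<close>-edges and \<open>d j M / 2\<close>
    loops, number at least \<open>card (\<D> j) + p - 1\<close>, as needed to connect that many
    components and \<open>p\<close> further vertices.\<close>
  have slack: "2 * card (\<D> j) + 2 * p \<le> 2 * (\<Sum>D\<in>\<D> j. \<delta> j D) + d j M + 2" if j: "j \<in> K" for j
    using up[OF j] sumd[OF j] dM[OF j] p(2) unfolding \<delta>_def sum\<D>[symmetric] by (simp add: algebra_simps)
  have "2 * (card (G' j) + card (components {..<Suc M} (G' j))) + 2 * n \<le> r * n + 2 * Suc M + 2"
    if j: "j \<in> K" for j
  proof -
    have "2 * (\<Sum>D\<in>\<D> j. \<alpha> j D) + 2 * card {D \<in> \<D> j. \<alpha> j D = 0} + 2 * p
      \<le> 2 * (\<Sum>D\<in>\<D> j. \<delta> j D) + d j M + 2"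
      by (rule component_count_bound[OF fD \<alpha>\<delta>[OF j] slack[OF j]])
    moreover have "card (components {..<Suc M} (G' j)) \<le> card {D \<in> \<D> j. \<alpha> j D = 0} + 1"
      unfolding comps[OF j] using card_insert_le_m1 by (simp add: card_insert_if fD)
    ultimately show ?thesis
      using cG'[OF j] sumd[OF j] dM[OF j] p(2) unfolding \<delta>_def \<alpha>_def sum\<D>[symmetric]
      by (simp add: algebra_simps)
  qed
  moreover have "\<exists>v\<in>C. deg (G' j) v < r"
    if j: "j \<in> K" and Mn': "Suc M < n" and C: "C \<in> components {..<Suc M} (G' j)" for j C
  proof -
    have p2: "2 \<le> p" using Mn' p(2) by linarith
    consider "C \<in> \<D> j" "\<alpha> j C = 0" | "C = X j" using C unfolding comps[OF j] by auto
    then show ?thesis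
    proof cases
      case 1
      then obtain v where v: "v \<in> C" "deg (G j) v < r" using defic[OF j] by blast
      then have "a j v = 0" using 1 fin unfolding \<alpha>_def by (meson sum_eq_0_iff)
      moreover have "v < M" using v(1) subD[OF 1(1)] by auto
      ultimately have "deg (G' j) v < r" using v(2) degv[of v j] j by simp
      then show ?thesis using v(1) by blast
    next
      case 2
      define big where "big = {D \<in> \<D> j. 2 \<le> \<delta> j D}"
      have bigD: "big \<subseteq> \<D> j" and fbig: "finite big" unfolding big_def using fD by auto
      have sumB: "(\<Sum>v\<in>B j. h v) = h M + (\<Sum>D\<in>big. \<Sum>v\<in>D. h v)" for h :: "nat \<Rightarrow> nat"
      proof -
        have "M \<notin> \<Union>big" using bigD subD by fastforce
        moreover have "sum h (\<Union>big) = (\<Sum>D\<in>big. \<Sum>v\<in>D. h v)"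
          using bigD fin components_disjoint unfolding \<D>_def by (subst sum.Union_disjoint) (blast, blast, simp)
        moreover have "finite (\<Union>big)" using fbig bigD fin by blast
        ultimately show ?thesis unfolding B_def big_def[symmetric] by simp
      qed
      \<comment> \<open>A component that is not big is attached by exactly one edge, so it adds the
        same amount to both sides of \<open>slack\<close> and can be cancelled.\<close>
      have "(\<Sum>D\<in>\<D> j - big. \<delta> j D) = (\<Sum>D\<in>\<D> j - big. 1)"
        using \<delta>pos[OF j] by (intro sum.cong) (force simp: big_def)+
      then have "(\<Sum>D\<in>\<D> j. \<delta> j D) + card big = (\<Sum>D\<in>big. \<delta> j D) + card (\<D> j)"
        using sum.subset_diff[OF bigD fD, of "\<delta> j"] card_Diff_subset[OF fbig bigD] card_mono[OF fD bigD] by simp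
      then have s: "2 * card big + 2 * p \<le> 2 * (\<Sum>D\<in>big. \<delta> j D) + d j M + 2" using slack[OF j] by linarith
      \<comment> \<open>At least \<open>p\<close> half-edges in \<open>B j\<close> force a positive
        fair share. Without big components, \<open>d j M\<close> is at least
        \<open>2 * p - 2\<close>, which suffices because \<open>2 \<le> p\<close>.\<close>
      have "p \<le> (\<Sum>v\<in>B j. d j v)"
      proof (cases "big = {}")
        case True
        then show ?thesis using s p2 unfolding sumB by simp
      next
        case False
        then have "0 < card big" using fbig by (simp add: card_gt_0_iff)
        then show ?thesis using s unfolding sumB \<delta>_def[symmetric] by linarith
      qed
      then have "0 < (\<Sum>v\<in>B j. a j v)" using aL[OF j, of "B j"] unfolding L_def by (cases "\<Sum>v\<in>B j. a j v") auto
      then have "0 < a j M \<or> (\<Sum>D\<in>big. \<alpha> j D) \<noteq> 0" unfolding sumB \<alpha>_def by auto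
      \<comment> \<open>If the new vertex takes half of a loop, it keeps an edge to the amalgamated
        rest, so its own degree so far is below \<open>r\<close>. Otherwise it touches a component
        with at least two available edges and cannot take all of them, which leaves a deficient
        vertex there.\<close>
      then consider "0 < a j M" | D where "D \<in> big" "0 < \<alpha> j D"
        by (metis bot_nat_0.not_eq_extremum sum.not_neutral_contains_not_neutral)
      then show ?thesis
      proof cases
        case 1
        then have "deg (G' j) M < r" using suma[OF j] degM[OF j] by linarith
        then show ?thesis unfolding 2 X_def by blast
      next
        case (2 D)
        then have D: "D \<in> \<D> j" "2 \<le> \<delta> j D" unfolding big_def by auto
        then have "\<alpha> j D < \<delta> j D" using fair_share_bounds(3)[of p "\<alpha> j D" "\<delta> j D"] \<alpha>\<delta>[OF j D(1)] p2 by simp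
        then obtain v where v: "v \<in> D" "a j v < d j v"
          unfolding \<alpha>_def \<delta>_def by (meson not_le sum_mono)
        then have "deg (G' j) v < r" using degv_le(1)[of v j] subD[OF D(1)] j by auto
        moreover have "v \<in> C" using v(1) D(1) 2(2) \<open>C = X j\<close> unfolding X_def by auto
        ultimately show ?thesis by blast
      qed
    qed
  qed
  moreover have "2 * r * Suc M \<le> r * n + 2 * card (G' j)" if j: "j \<in> K" and Mn': "Suc M < n" for j
  proof -
    have p2: "2 \<le> p" using Mn' p(2) by linarith
    \<comment> \<open>Each half-edge taken from a loop uses up that whole loop, so the new vertex
      must take at most half of \<open>d j M\<close>. Rounding up cannot violate this because
      \<open>d j M\<close> is even, by the evenness of \<open>r * n\<close>.\<close>
    have "even (d j M)" using dM[OF j] adm unfolding two_admissible_def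
      by (metis dvd_add_left_iff dvd_add_right_iff dvd_triv_left mult.assoc)
    then have "2 * a j M \<le> d j M"
      using fair_share_bounds(4)[of p "a j M" "d j M"] aL[OF j, of "{M}"] ale[of j M] p2
      unfolding L_def by (cases "d j M = 0") auto
    then show ?thesis using suma[OF j] cG'[OF j] dM[OF j] by (simp add: algebra_simps)
  qed
  moreover have "partial_factorization n r lam (Suc M) f'"
    unfolding partial_factorization_def K_def[symmetric] G'_def[symmetric]
  proof (intro conjI ballI allI impI)
    fix e assume "e \<in> lamK lam (Suc M)"
    then consider "e \<in> lamK lam M" | v i where "e = ({v, M}, i)" "v < M" "i < lam"
      unfolding lamK_Suc star_def by auto
    then show "f' e \<in> K" using f'old[of e] f'new pf g(1) by cases simp_all
  next
    fix j v assume j: "j \<in> K" and "v < Suc M"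
    then consider "v < M" | "v = M" by linarith
    then show "deg (G' j) v \<le> r"
      using degv_le(2)[of v j] degM[OF j] suma[OF j] j by cases auto
  qed
  ultimately have "extendable n r lam (Suc M) f'"
    unfolding extendable_def K_def[symmetric] G'_def[symmetric] by blast
  then show ?thesis using f'old by blast
qed

section \<open>Reaching all \<open>n\<close> vertices\<close>

lemma extendable_iterate:
  assumes "two_admissible n r lam" "extendable n r lam m f" "m \<le> k" "k \<le> n"
  shows "\<exists>g. (\<forall>e\<in>lamK lam m. g e = f e) \<and> extendable n r lam k g"
  using assms(3,4)
proof (induction k rule: dec_induct)
  case base
  show ?case using assms(2) by (intro exI[of _ f]) simp
next
  case (step k)
  then obtain g where g: "\<forall>e\<in>lamK lam m. g e = f e" "extendable n r lam k g" by auto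
  then obtain h where h: "\<forall>e\<in>lamK lam k. h e = g e" "extendable n r lam (Suc k) h"
    using extendable_Suc[OF assms(1) _ g(2)] step.prems by auto
  moreover have "lamK lam m \<subseteq> lamK lam k" using step.hyps(1) by (rule lamK_mono)
  ultimately show ?case using g(1) by (intro exI[of _ h]) auto
qed

text \<open>At each vertex the degrees over all colours sum to \<open>r\<close> times the number of
  colours, so the bound \<open>r\<close> is attained in each colour. With \<open>r * n / 2\<close>
  edges in a class, the upper condition leaves room for only one component.\<close>

lemma extendable_imp_connected_factorization:
  assumes "two_admissible n r lam" "n > 0" "extendable n r lam n g"
  shows "connected_factorization n r lam g"
proof -
  let ?K = "colours n r lam" and ?G = "colour_class (lamK lam n) g"
  have pf: "\<forall>e\<in>lamK lam n. g e \<in> ?K" and le: "\<And>j v. j \<in> ?K \<Longrightarrow> v < n \<Longrightarrow> deg (?G j) v \<le> r"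
    using assms(3) unfolding extendable_def partial_factorization_def by auto
  have deg: "deg (?G j) v = r" if j: "j \<in> ?K" and v: "v < n" for j v
  proof (rule ccontr)
    assume "deg (?G j) v \<noteq> r"
    then have "(\<Sum>i\<in>?K. deg (?G i) v) < (\<Sum>i\<in>?K. r)"
      using le v j finite_colours by (intro sum_strict_mono_ex1) (auto simp: le_less)
    moreover have "(\<Sum>i\<in>?K. r) = lam * (n - 1)"
      using assms(1) unfolding two_admissible_def colours_def by simp
    ultimately show False using sum_deg_colours[OF pf v] by simp
  qed
  have "connected_graph {..<n} (?G j)" if j: "j \<in> ?K" for j
  proof -
    have "2 * card (?G j) = n * r"
      using handshake[OF _ finite_colour_class[OF finite_lamK] graph_on_colour_class, of n lam g j] deg[OF j] by simp
    then have "card (components {..<n} (?G j)) \<le> 1"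
      using assms(3) j unfolding extendable_def by (auto simp: algebra_simps)
    then show ?thesis using assms(2) by (subst connected_graph_iff_card_components) auto
  qed
  then show ?thesis using pf deg unfolding connected_factorization_def regular_def by simp
qed

section \<open>Necessity of the conditions\<close>

lemma connected_factorization_two_admissible:
  assumes "connected_factorization n r lam g" "lam > 0" "n > 1"
  shows "two_admissible n r lam"
proof -
  let ?K = "colours n r lam" and ?H = "colour_class (lamK lam n) g"
  have pf: "\<forall>e\<in>lamK lam n. g e \<in> ?K" and deg: "\<And>j v. j \<in> ?K \<Longrightarrow> v < n \<Longrightarrow> deg (?H j) v = r"
    using assms(1) unfolding connected_factorization_def regular_def by auto
  \<comment> \<open>Counting the edges at vertex 0 shows that the integer division in
    \<open>colours\<close> has no remainder. As the product is positive, some colour exists, and the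
    handshake lemma applied to its class gives the parity of \<open>r * n\<close>.\<close>
  have *: "card ?K * r = lam * (n - 1)"
    using sum_deg_colours[OF pf, of 0] deg assms(3) by simp
  have "card ?K \<noteq> 0"
  proof
    assume "card ?K = 0"
    then have "lam * (n - 1) = 0" using * by (metis mult_0)
    then show False using assms(2,3) by simp
  qed
  then obtain j where "j \<in> ?K" by fastforce
  then have "2 dvd r * n"
    using handshake[OF _ finite_colour_class[OF finite_lamK] graph_on_colour_class, of n lam g j] deg
    by (simp add: mult.commute)
  moreover have "r dvd lam * (n - 1)" using * by (metis dvd_triv_right)
  ultimately show ?thesis unfolding two_admissible_def by simp
qed

lemma connected_factorization_restrict:
  assumes cf: "connected_factorization n r lam g" and mn: "m < n" and j: "j \<in> colours n r lam"
    and fg: "\<And>e. e \<in> lamK lam m \<Longrightarrow> g e = f e"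
  defines "G \<equiv> colour_class (lamK lam m) f j"
  shows "C \<in> components {..<m} G \<Longrightarrow> \<exists>v\<in>C. deg G v \<noteq> r"
    and "2 * r * m \<le> r * n + 2 * card G"
    and "2 * (card G + card (components {..<m} G)) + 2 * n \<le> r * n + 2 * m + 2"
proof -
  define H where "H = colour_class (lamK lam n) g j"
  have GH: "G \<subseteq> H"
    using lamK_mono[of m n lam] mn fg unfolding G_def H_def colour_class_def by auto
  have gG: "graph_on {..<m} G" and gH: "graph_on {..<n} H"
    unfolding G_def H_def by (rule graph_on_colour_class)+
  have fH: "finite H" unfolding H_def by (intro finite_colour_class finite_lamK)
  have fG: "finite G" using GH fH by (rule finite_subset)
  have degH: "deg H v = r" if "v < n" for v
    using cf j that unfolding connected_factorization_def regular_def H_def by auto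
  have conn: "connected_graph {..<n} H"
    using cf j unfolding connected_factorization_def H_def by auto
  have cH: "2 * card H = r * n" using handshake[OF _ fH gH] degH by (simp add: mult.commute)
  have cHG: "card H = card G + card (H - G)"
    using card_Diff_subset[OF fG GH] card_mono[OF fH GH] by simp
  show "\<exists>v\<in>C. deg G v \<noteq> r" if C: "C \<in> components {..<m} G"
  proof (rule ccontr)
    assume "\<not> ?thesis"
    then have reg: "deg G v = r" if "v \<in> C" for v using that by blast
    have Cm: "C \<subseteq> {..<m}" using C by (rule component_subset)
    \<comment> \<open>At a vertex of a regular component, \<open>G\<close> already uses all
      \<open>r\<close> edges of \<open>H\<close>, so \<open>H\<close> has no further edge there.
      Hence the component is closed in \<open>H\<close> and cannot be linked to the outside vertex
      \<open>m\<close>.\<close>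
    have closed: "v \<in> C" if u: "u \<in> C" "(u, v) \<in> adj H" for u v
    proof -
      obtain i where e: "({u, v}, i) \<in> H" using u(2) unfolding adj_def by blast
      have eq: "{e \<in> G. u \<in> fst e} = {e \<in> H. u \<in> fst e}"
      proof (rule card_subset_eq)
        have "u < m" using u(1) Cm by blast
        then have "u < n" using mn by simp
        then have "deg G u = deg H u" using reg[OF u(1)] degH by simp
        then show "card {e \<in> G. u \<in> fst e} = card {e \<in> H. u \<in> fst e}" unfolding deg_def .
      qed (use fH GH in auto)
      have "({u, v}, i) \<in> {e \<in> H. u \<in> fst e}" using e by simp
      then have "({u, v}, i) \<in> G" unfolding eq[symmetric] by simp
      then show ?thesis using component_closed[OF gG C u(1)] unfolding adj_def by blast
    qed
    obtain u where u: "u \<in> C" using C component_nonempty by (metis ex_in_conv)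
    then have "(u, m) \<in> (adj H)\<^sup>*"
      using conn Cm mn unfolding connected_graph_def linked_def by auto
    then have "m \<in> C" using u by (induction rule: rtrancl_induct) (auto intro: closed)
    then show False using Cm by auto
  qed
  show "2 * r * m \<le> r * n + 2 * card G"
  proof -
    have "deg H v = deg G v + deg (H - G) v" for v
    proof -
      have "{e \<in> H. v \<in> fst e} = {e \<in> G. v \<in> fst e} \<union> {e \<in> H - G. v \<in> fst e}" using GH by auto
      then show ?thesis unfolding deg_def using fH fG by (simp add: card_Un_disjoint disjoint_iff)
    qed
    then have "(\<Sum>v<m. deg H v) = 2 * card G + (\<Sum>v<m. deg (H - G) v)"
      using handshake[OF _ fG gG] by (simp add: sum.distrib)
    moreover have "(\<Sum>v<m. deg (H - G) v) = (\<Sum>e\<in>H - G. card {v \<in> {..<m}. v \<in> fst e})"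
      unfolding deg_def using fH by (intro sum_multicount_gen) auto
    \<comment> \<open>An edge of \<open>H\<close> with both ends below \<open>m\<close> is coloured
      by \<open>f\<close> and thus lies in \<open>G\<close>. So each edge of \<open>H - G\<close>
      supplies at most one of the degrees missing below \<open>m\<close>.\<close>
    moreover have "\<dots> \<le> (\<Sum>e\<in>H - G. 1)"
    proof (rule sum_mono)
      fix e assume e: "e \<in> H - G"
      then obtain x y i where xy: "e = ({x, y}, i)" "x \<noteq> y" using graph_onE[OF gH] by blast
      have "\<not> (x < m \<and> y < m)"
      proof
        assume "x < m \<and> y < m"
        then have "e \<in> lamK lam m" using e xy unfolding H_def colour_class_def lamK_def by auto
        then have "e \<in> G" using e fg unfolding G_def H_def colour_class_def by auto
        then show False using e by simp
      qed
      then have "{v \<in> {..<m}. v \<in> fst e} \<subseteq> {x} \<or> {v \<in> {..<m}. v \<in> fst e} \<subseteq> {y}" using xy by auto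
      then show "card {v \<in> {..<m}. v \<in> fst e} \<le> 1"
        using card_mono[of "{x}" "{v \<in> {..<m}. v \<in> fst e}"]
          card_mono[of "{y}" "{v \<in> {..<m}. v \<in> fst e}"] by auto
    qed
    moreover have "(\<Sum>v<m. deg H v) = r * m" using degH mn by simp
    ultimately show ?thesis using cH cHG by simp
  qed
  show "2 * (card G + card (components {..<m} G)) + 2 * n \<le> r * n + 2 * m + 2"
  proof -
    \<comment> \<open>On all \<open>n\<close> vertices, \<open>G\<close> has \<open>n - m\<close>
      additional isolated components, and each edge of \<open>H - G\<close> lowers the count by at
      most one on the way to a single component.\<close>
    have "card (components {..<n} G) \<le> card (components {..<n} H) + card (H - G)"
      using card_components_Un[of "{..<n}" "H - G" G] fH gH GH by (simp add: Un_absorb1)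
    moreover have "card (components {..<n} H) \<le> 1"
      using conn mn by (subst connected_graph_iff_card_components[symmetric]) auto
    moreover have "card (components {..<n} G) = card (components {..<m} G) + (n - m)"
      using card_components_isolated[OF gG, of "{..<n}"] mn by (simp add: card_Diff_subset)
    ultimately show ?thesis using cH cHG mn by simp
  qed
qed

theorem theorem7p6:
  fixes n m r lam :: nat and f :: "nat medge \<Rightarrow> nat"
  assumes "r > 0" and "lam > 0" and "m > 2" and "n > m"
    and "partial_factorization n r lam m f"
  shows "extends_to_connected_factorization n r lam m f \<longleftrightarrow>
     two_admissible n r lam \<and>
     (\<forall>j\<in>colours n r lam.
        \<forall>C\<in>components {..<m} (colour_class (lamK lam m) f j).
          \<not> regular r C (induced_edges (colour_class (lamK lam m) f j) C)) \<and>
     (\<forall>j\<in>colours n r lam.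
        real r * real m - real r * real n / 2 \<le> real (card (colour_class (lamK lam m) f j)) \<and>
        real (card (colour_class (lamK lam m) f j))
          \<le> real r * real n / 2 - real n + real m
             - real (card (components {..<m} (colour_class (lamK lam m) f j))) + 1)"
proof -
  let ?G = "colour_class (lamK lam m) f"
  let ?c = "\<lambda>j. card (components {..<m} (?G j))"
  have regular_iff: "\<not> regular r C (induced_edges (?G j) C) \<longleftrightarrow> (\<exists>v\<in>C. deg (?G j) v \<noteq> r)"
    if "C \<in> components {..<m} (?G j)" for C j
    unfolding regular_def using deg_component[OF graph_on_colour_class that] by auto
  \<comment> \<open>Doubling clears the halves, and moving subtracted terms across turns the real
    inequalities into ones over the naturals without truncated subtraction.\<close>
  have lower_iff: "real r * real m - real r * real n / 2 \<le> real (card (?G j)) \<longleftrightarrow>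
    2 * r * m \<le> r * n + 2 * card (?G j)" for j
  proof -
    have "2 * r * m \<le> r * n + 2 * card (?G j) \<longleftrightarrow> real (2 * r * m) \<le> real (r * n + 2 * card (?G j))"
      by (rule of_nat_le_iff[symmetric])
    then show ?thesis by (simp add: field_simps)
  qed
  have upper_iff: "real (card (?G j)) \<le> real r * real n / 2 - real n + real m - real (?c j) + 1 \<longleftrightarrow>
    2 * (card (?G j) + ?c j) + 2 * n \<le> r * n + 2 * m + 2" for j
  proof -
    have "2 * (card (?G j) + ?c j) + 2 * n \<le> r * n + 2 * m + 2 \<longleftrightarrow>
      real (2 * (card (?G j) + ?c j) + 2 * n) \<le> real (r * n + 2 * m + 2)"
      by (rule of_nat_le_iff[symmetric])
    then show ?thesis by (simp add: field_simps)
  qed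
  show ?thesis (is "_ \<longleftrightarrow> ?R")
  proof
    assume "extends_to_connected_factorization n r lam m f"
    then obtain g where g: "connected_factorization n r lam g" "\<And>e. e \<in> lamK lam m \<Longrightarrow> g e = f e"
      unfolding extends_to_connected_factorization_def by blast
    have "two_admissible n r lam"
      using connected_factorization_two_admissible[OF g(1)] assms by simp
    then show ?R
      using connected_factorization_restrict[OF g(1) assms(4) _ g(2)]
      unfolding lower_iff upper_iff by (simp add: regular_iff)
  next
    assume R: ?R
    then have adm: "two_admissible n r lam" by blast
    \<comment> \<open>Degrees in a partial factorization never exceed \<open>r\<close>, so failing
      to be regular means having a vertex of smaller degree.\<close>
    have "\<exists>v\<in>C. deg (?G j) v < r" if j: "j \<in> colours n r lam" and C: "C \<in> components {..<m} (?G j)" for j C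
    proof -
      have "\<not> regular r C (induced_edges (?G j) C)" using R j C by blast
      then obtain v where "v \<in> C" "deg (?G j) v \<noteq> r" using regular_iff[OF C] by blast
      moreover have "v < m" using calculation(1) component_subset[OF C] by auto
      ultimately show ?thesis
        using assms(5) j unfolding partial_factorization_def by (auto simp: le_less)
    qed
    moreover have "2 * r * m \<le> r * n + 2 * card (?G j)"
      "2 * (card (?G j) + ?c j) + 2 * n \<le> r * n + 2 * m + 2" if "j \<in> colours n r lam" for j
      using R that lower_iff[of j] upper_iff[of j] by simp_all
    ultimately have "extendable n r lam m f"
      using assms(5) unfolding extendable_def by simp
    then obtain g where "\<forall>e\<in>lamK lam m. g e = f e" "extendable n r lam n g"
      using extendable_iterate[OF adm, of m f n] assms(4) by auto
    then show "extends_to_connected_factorization n r lam m f"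
      using extendable_imp_connected_factorization[OF adm] assms(4)
      unfolding extends_to_connected_factorization_def by auto
  qed
qed

end
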